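(* Let $1\leq p<\infty$ and let $(u,\psi)$ be a pair of entire functions on $\mathbb{C}$ such that the weighted composition operator $W_{(u,\psi)}$, $W_{(u,\psi)}f=u\cdot (f\circ\psi)$, is bounded on the Fock space $\mathcal{F}_p$. Then $W_{(u,\psi)}$ is not supercyclic on $\mathcal{F}_p$.
   Context: For $1\le p<\infty$, the Fock space $\mathcal{F}_p$ is the Banach space of all entire functions $f:\mathbb{C}\to\mathbb{C}$ with $$\|f\|_p^p=\frac{p}{2\pi}\int_{\mathbb{C}}|f(z)|^p e^{-\frac{p|z|^2}{2}}\,dA(z)<\infty,$$ where $dA$ is Lebesgue area measure on $\mathbb{C}$. A bounded linear operator $T$ on a Banach space $\mathcal{X}$ is supercyclic if there exists $f\in\mathcal{X}$ such that the projective orbit $\{\lambda T^n f:\lambda\in\mathbb{C},\ n\in\mathbb{N}_0\}$ is dense in $\mathcal{X}$, where $T^n$ is the $n$-th iterate of $T$ and $T^0=I$ is the identity. *)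

theory Defs
  imports "HOL-Complex_Analysis.Complex_Analysis"
begin

text \<open>The exponent is a real parameter, so the Fock space is a set of functions with an explicit
  norm rather than a type. The integrand below is nonnegative and continuous, so integrability
  says exactly that the integral over the plane is finite.\<close>

definition fock_integrand :: "real \<Rightarrow> (complex \<Rightarrow> complex) \<Rightarrow> complex \<Rightarrow> real" where
  "fock_integrand p f z = cmod (f z) powr p * exp (- (p * (cmod z)\<^sup>2 / 2))"

definition fock_space :: "real \<Rightarrow> (complex \<Rightarrow> complex) set" where
  "fock_space p = {f. f holomorphic_on UNIV \<and> integrable lborel (fock_integrand p f)}"

definition fock_norm :: "real \<Rightarrow> (complex \<Rightarrow> complex) \<Rightarrow> real" where
  "fock_norm p f = (p / (2 * pi) * (LINT z|lborel. fock_integrand p f z)) powr (1 / p)"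

definition weighted_comp ::
  "(complex \<Rightarrow> complex) \<Rightarrow> (complex \<Rightarrow> complex) \<Rightarrow> (complex \<Rightarrow> complex) \<Rightarrow> complex \<Rightarrow> complex" where
  "weighted_comp u \<psi> f = (\<lambda>z. u z * f (\<psi> z))"

definition bounded_linear_operator_on ::
  "('a \<Rightarrow> complex) set \<Rightarrow> (('a \<Rightarrow> complex) \<Rightarrow> real) \<Rightarrow> (('a \<Rightarrow> complex) \<Rightarrow> 'a \<Rightarrow> complex) \<Rightarrow> bool"
where
  "bounded_linear_operator_on X N T \<longleftrightarrow>
     (\<forall>f\<in>X. T f \<in> X) \<and>
     (\<forall>f\<in>X. \<forall>g\<in>X. T (\<lambda>z. f z + g z) = (\<lambda>z. T f z + T g z)) \<and>
     (\<forall>c. \<forall>f\<in>X. T (\<lambda>z. c * f z) = (\<lambda>z. c * T f z)) \<and>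
     (\<exists>C. \<forall>f\<in>X. N (T f) \<le> C * N f)"

definition projective_orbit ::
  "(('a \<Rightarrow> complex) \<Rightarrow> 'a \<Rightarrow> complex) \<Rightarrow> ('a \<Rightarrow> complex) \<Rightarrow> ('a \<Rightarrow> complex) set" where
  "projective_orbit T f = {(\<lambda>z. c * (T ^^ n) f z) | c n. True}"

definition norm_dense_in ::
  "('a \<Rightarrow> complex) set \<Rightarrow> (('a \<Rightarrow> complex) \<Rightarrow> real) \<Rightarrow> ('a \<Rightarrow> complex) set \<Rightarrow> bool" where
  "norm_dense_in X N S \<longleftrightarrow> S \<subseteq> X \<and> (\<forall>g\<in>X. \<forall>e>0. \<exists>h\<in>S. N (\<lambda>z. g z - h z) < e)"

text \<open>Intended for operators that are bounded and linear on the normed space in question.\<close>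

definition supercyclic_on ::
  "('a \<Rightarrow> complex) set \<Rightarrow> (('a \<Rightarrow> complex) \<Rightarrow> real) \<Rightarrow> (('a \<Rightarrow> complex) \<Rightarrow> 'a \<Rightarrow> complex) \<Rightarrow> bool"
where
  "supercyclic_on X N T \<longleftrightarrow> (\<exists>f\<in>X. norm_dense_in X N (projective_orbit T f))"

end

theory Submission
  imports Defs "HOL-Probability.Distributions"
begin

text \<open>Point evaluations satisfy \<open>\<bar>f w\<bar> exp (-\<bar>w\<bar>\<^sup>2/2) \<le> C \<parallel>f\<parallel>\<close>, so testing boundedness on normalized
  reproducing kernels bounds \<open>\<bar>u z\<bar> exp ((\<bar>\<psi> z\<bar>\<^sup>2 - \<bar>z\<bar>\<^sup>2)/2)\<close>. If \<open>u\<close> has a zero, all iterates vanish there and the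
  orbit is visibly not dense. Otherwise \<open>u = exp h\<close>, and averaging over circles shows that
  \<open>\<psi> z = a z + b\<close> with \<open>\<bar>a\<bar> \<le> 1\<close>; when \<open>\<bar>a\<bar> = 1\<close>, Liouville's theorem identifies \<open>u\<close> as a multiple of
  \<open>exp (-a cnj b z)\<close>.

  If \<open>\<psi>\<close> fixes \<open>z0\<close>, then the quotients \<open>(T^n f) (z0 + 1) / (T^n f) z0\<close> stay bounded, while density of the
  projective orbit would make them approximate every value. If \<open>\<psi>\<close> is a proper translation, \<open>T\<close> is a
  multiple of a Weyl translation \<open>U\<close>, which is isometric in the weaker norm \<open>sup \<bar>f z\<bar> exp (-\<bar>z\<bar>\<^sup>2/2)\<close>;
  supercyclicity would then force every \<open>U^n - 1\<close> to be a multiple of an isometry, which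
  fails on the constant function \<open>1\<close> for large \<open>n\<close>.\<close>

section \<open>Lebesgue measure on the complex plane\<close>

text \<open>Boxes determine \<open>lborel\<close>, and in real and imaginary parts a box is a
  product of intervals. This makes Tonelli available in Cartesian coordinates.\<close>

lemma lborel_complex_eq_distr:
  "(lborel :: complex measure) = distr (lborel \<Otimes>\<^sub>M lborel) borel (\<lambda>(x, y). Complex x y)"
proof (rule lborel_eqI)
  fix l u :: complex
  assume le: "\<And>b. b \<in> Basis \<Longrightarrow> l \<bullet> b \<le> u \<bullet> b"
  have Re: "Re l \<le> Re u" and Im: "Im l \<le> Im u"
    using le[of 1] le[of \<i>] by (auto simp: Basis_complex_def inner_complex_def)
  have m: "(\<lambda>(x, y). Complex x y) \<in> lborel \<Otimes>\<^sub>M lborel \<rightarrow>\<^sub>M borel"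
    unfolding Complex_eq case_prod_beta by measurable
  have v: "(\<lambda>(x, y). Complex x y) -` box l u \<inter> space (lborel \<Otimes>\<^sub>M lborel)
      = {Re l<..<Re u} \<times> {Im l<..<Im u}"
    by (auto simp: box_def Basis_complex_def inner_complex_def space_pair_measure)
  have "emeasure (distr (lborel \<Otimes>\<^sub>M lborel) borel (\<lambda>(x, y). Complex x y)) (box l u)
      = emeasure (lborel \<Otimes>\<^sub>M lborel) ({Re l<..<Re u} \<times> {Im l<..<Im u})"
    by (subst emeasure_distr[OF m]) (simp_all add: v)
  also have "\<dots> = ennreal (Re u - Re l) * ennreal (Im u - Im l)"
    by (subst lborel.emeasure_pair_measure_Times) (use Re Im in auto)
  also have "\<dots> = ennreal (\<Prod>b\<in>Basis. (u - l) \<bullet> b)"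
    using Re Im by (simp add: Basis_complex_def inner_complex_def ennreal_mult)
  finally show "emeasure (distr (lborel \<Otimes>\<^sub>M lborel) borel (\<lambda>(x, y). Complex x y)) (box l u)
      = ennreal (\<Prod>b\<in>Basis. (u - l) \<bullet> b)" .
qed simp

text \<open>Both orders of integration are recorded because horizontal and vertical shears need
  opposite inner variables.\<close>

lemma nn_integral_lborel_complex:
  assumes [measurable]: "F \<in> borel_measurable borel"
  shows "(\<integral>\<^sup>+z. F z \<partial>lborel) = (\<integral>\<^sup>+x. \<integral>\<^sup>+y. F (Complex x y) \<partial>lborel \<partial>lborel)"
    and "(\<integral>\<^sup>+z. F z \<partial>lborel) = (\<integral>\<^sup>+y. \<integral>\<^sup>+x. F (Complex x y) \<partial>lborel \<partial>lborel)"
proof -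
  have m[measurable]: "(\<lambda>(x, y). Complex x y) \<in> borel \<Otimes>\<^sub>M borel \<rightarrow>\<^sub>M borel"
    unfolding Complex_eq case_prod_beta by measurable
  have m': "(\<lambda>(x, y). Complex x y) \<in> lborel \<Otimes>\<^sub>M lborel \<rightarrow>\<^sub>M borel"
    unfolding Complex_eq case_prod_beta by measurable
  have *: "(\<integral>\<^sup>+z. F z \<partial>lborel) = (\<integral>\<^sup>+w. F (Complex (fst w) (snd w)) \<partial>(lborel \<Otimes>\<^sub>M lborel))"
    by (subst lborel_complex_eq_distr, subst nn_integral_distr[OF m'])
       (auto simp: case_prod_beta)
  have F[measurable]: "(\<lambda>w. F (Complex (fst w) (snd w))) \<in> borel_measurable (borel \<Otimes>\<^sub>M borel)"
    using measurable_compose[OF m assms] by (simp add: case_prod_beta)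
  show "(\<integral>\<^sup>+z. F z \<partial>lborel) = (\<integral>\<^sup>+x. \<integral>\<^sup>+y. F (Complex x y) \<partial>lborel \<partial>lborel)"
    unfolding * by (subst lborel.nn_integral_fst[symmetric]) (use F in auto)
  show "(\<integral>\<^sup>+z. F z \<partial>lborel) = (\<integral>\<^sup>+y. \<integral>\<^sup>+x. F (Complex x y) \<partial>lborel \<partial>lborel)"
    unfolding * by (subst lborel_pair.nn_integral_snd[symmetric]) (use F in auto)
qed

lemma nn_integral_lborel_translate:
  fixes F :: "'a::euclidean_space \<Rightarrow> ennreal"
  assumes [measurable]: "F \<in> borel_measurable borel"
  shows "(\<integral>\<^sup>+z. F (z + c) \<partial>lborel) = (\<integral>\<^sup>+z. F z \<partial>lborel)"
proof -
  have "(\<integral>\<^sup>+z. F z \<partial>lborel) = (\<integral>\<^sup>+z. F z \<partial>distr lborel borel ((+) c))"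
    by (subst lborel_distr_plus) simp
  also have "\<dots> = (\<integral>\<^sup>+z. F (z + c) \<partial>lborel)"
    by (subst nn_integral_distr) (auto simp: add.commute)
  finally show ?thesis by simp
qed

text \<open>With the unchanged coordinate held fixed, a shear is a translation of the other one;
  Tonelli with that variable innermost reduces to translation invariance on the line.\<close>

lemma nn_integral_lborel_shear:
  fixes t :: real
  assumes [measurable]: "F \<in> borel_measurable borel"
  shows "(\<integral>\<^sup>+z. F (z + of_real (t * Im z)) \<partial>lborel) = (\<integral>\<^sup>+z. F z \<partial>lborel)"
    and "(\<integral>\<^sup>+z. F (z + \<i> * of_real (t * Re z)) \<partial>lborel) = (\<integral>\<^sup>+z. F z \<partial>lborel)"
proof -
  have C: "Complex x y + of_real (t * y) = Complex (x + t * y) y"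
    "Complex x y + \<i> * of_real (t * x) = Complex x (y + t * x)" for x y
    by (auto simp: complex_eq_iff)
  have Fm: "(\<lambda>x. F (Complex x y)) \<in> borel_measurable borel"
    "(\<lambda>x. F (Complex y x)) \<in> borel_measurable borel" for y
    unfolding Complex_eq by measurable
  have [measurable]: "Re \<in> borel_measurable borel" "Im \<in> borel_measurable borel"
    by (auto intro!: borel_measurable_continuous_onI continuous_intros)
  have "(\<lambda>z. F (z + of_real (t * Im z))) \<in> borel_measurable borel"
     "(\<lambda>z. F (z + \<i> * of_real (t * Re z))) \<in> borel_measurable borel"
    by measurable
  note mm = this
  show "(\<integral>\<^sup>+z. F (z + of_real (t * Im z)) \<partial>lborel) = (\<integral>\<^sup>+z. F z \<partial>lborel)"
    unfolding nn_integral_lborel_complex(2)[OF mm(1)] nn_integral_lborel_complex(2)[OF assms]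
    using nn_integral_lborel_translate[OF Fm(1)] by (simp only: complex.sel C)
  show "(\<integral>\<^sup>+z. F (z + \<i> * of_real (t * Re z)) \<partial>lborel) = (\<integral>\<^sup>+z. F z \<partial>lborel)"
    unfolding nn_integral_lborel_complex(1)[OF mm(2)] nn_integral_lborel_complex(1)[OF assms]
    using nn_integral_lborel_translate[OF Fm(2)] by (simp only: complex.sel C)
qed

lemma nn_integral_lborel_rotate_aux:
  assumes [measurable]: "F \<in> borel_measurable borel" and c: "cmod c = 1" "Re c \<noteq> -1"
  shows "(\<integral>\<^sup>+z. F (c * z) \<partial>lborel) = (\<integral>\<^sup>+z. F z \<partial>lborel)"
proof -
  \<comment> \<open>A rotation is the product of a horizontal, a vertical and the same horizontal shear.\<close>
  define t where "t = - Im c / (1 + Re c)"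
  have c2: "(Re c)\<^sup>2 + (Im c)\<^sup>2 = 1"
    using c(1) by (simp add: cmod_def)
  have nz: "1 + Re c \<noteq> 0" using c(2) by linarith
  \<comment> \<open>If \<open>c\<close> has argument \<theta>, then \<open>t\<close> is minus the
    tangent of \<theta>/2. The half-angle identities \<open>ty\<close> and \<open>tx\<close> are
    what the composed shears need to reproduce the rotation matrix.\<close>
  have ty: "1 + t * Im c = Re c"
    using c2 nz unfolding t_def by (simp add: field_simps power2_eq_square)
  have tx: "t * (1 + Re c) = - Im c"
    using nz unfolding t_def by simp
  define S where "S = (\<lambda>z. z + complex_of_real (t * Im z))"
  define R where "R = (\<lambda>z. z + \<i> * complex_of_real (Im c * Re z))"
  have [measurable]: "Re \<in> borel_measurable borel" "Im \<in> borel_measurable borel"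
    by (auto intro!: borel_measurable_continuous_onI continuous_intros)
  have [measurable]: "S \<in> borel_measurable borel" "R \<in> borel_measurable borel"
    unfolding S_def R_def by measurable
  have eq: "c * z = S (R (S z))" for z
  proof -
    have i: "Im (R (S z)) = Im c * Re z + Re c * Im z"
    proof -
      have "Im (R (S z)) = Im c * Re z + (1 + t * Im c) * Im z"
        unfolding R_def S_def by (simp add: algebra_simps)
      then show ?thesis by (simp only: ty)
    qed
    have "Re (S (R (S z))) = Re z + t * Im z + t * Im (R (S z))"
      unfolding S_def R_def by simp
    also have "\<dots> = (1 + t * Im c) * Re z + (t * (1 + Re c)) * Im z"
      unfolding i by (simp add: algebra_simps)
    finally have "Re (S (R (S z))) = Re c * Re z - Im c * Im z"
      by (simp only: ty tx)
    moreover have "Im (S (R (S z))) = Im (R (S z))" by (simp add: S_def)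
    ultimately show ?thesis using i by (simp add: complex_eq_iff)
  qed
  have S: "(\<integral>\<^sup>+z. G (S z) \<partial>lborel) = (\<integral>\<^sup>+z. G z \<partial>lborel)"
    if "G \<in> borel_measurable borel" for G :: "complex \<Rightarrow> ennreal"
    using nn_integral_lborel_shear(1)[OF that] unfolding S_def .
  have R: "(\<integral>\<^sup>+z. G (R z) \<partial>lborel) = (\<integral>\<^sup>+z. G z \<partial>lborel)"
    if "G \<in> borel_measurable borel" for G :: "complex \<Rightarrow> ennreal"
    using nn_integral_lborel_shear(2)[OF that] unfolding R_def .
  have "(\<integral>\<^sup>+z. F (c * z) \<partial>lborel) = (\<integral>\<^sup>+z. F (S (R (S z))) \<partial>lborel)"
    by (simp only: eq)
  also have "\<dots> = (\<integral>\<^sup>+z. F (S (R z)) \<partial>lborel)" by (rule S) measurable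
  also have "\<dots> = (\<integral>\<^sup>+z. F (S z) \<partial>lborel)" by (rule R) measurable
  also have "\<dots> = (\<integral>\<^sup>+z. F z \<partial>lborel)" by (rule S) measurable
  finally show ?thesis .
qed

lemma nn_integral_lborel_rotate:
  assumes [measurable]: "F \<in> borel_measurable borel" and c: "cmod c = 1"
  shows "(\<integral>\<^sup>+z. F (c * z) \<partial>lborel) = (\<integral>\<^sup>+z. F z \<partial>lborel)"
proof -
  \<comment> \<open>The shear decomposition breaks down at \<open>c = -1\<close>, so rotate twice by a square root.\<close>
  define d where "d = csqrt c"
  have dd: "c = d * d" by (simp add: d_def power2_eq_square[symmetric])
  have d: "cmod d = 1" using c by (simp add: d_def)
  have "0 \<le> Re d" unfolding d_def using csqrt_principal[of c] by auto
  then have rd: "Re d \<noteq> -1" by auto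
  have "(\<integral>\<^sup>+z. F (c * z) \<partial>lborel) = (\<integral>\<^sup>+z. F (d * (d * z)) \<partial>lborel)" by (simp add: dd mult.assoc)
  also have "\<dots> = (\<integral>\<^sup>+z. F (d * z) \<partial>lborel)"
    by (rule nn_integral_lborel_rotate_aux[OF _ d rd]) measurable
  also have "\<dots> = (\<integral>\<^sup>+z. F z \<partial>lborel)"
    by (rule nn_integral_lborel_rotate_aux[OF _ d rd]) measurable
  finally show ?thesis .
qed

section \<open>Weyl translations and point evaluations\<close>

text \<open>Cauchy's formula for derivatives on a circle, parametrized by the unit interval. For
  \<open>n = 0\<close> it is the mean value property; in general it isolates one Taylor
  coefficient.\<close>

lemma cauchy_coefficient_circle_mean:
  assumes f: "f holomorphic_on UNIV" and r: "0 < r"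
  shows "((\<lambda>t. f (of_real r * exp (2 * of_real pi * \<i> * of_real t))
             / (of_real r * exp (2 * of_real pi * \<i> * of_real t)) ^ n)
          has_integral (deriv ^^ n) f 0 / fact n) {0..1::real}"
proof -
  have "((\<lambda>u. f u / (u - 0) ^ Suc n) has_contour_integral
      ((2 * pi * \<i>) / fact n * (deriv ^^ n) f 0)) (circlepath 0 r)"
    by (rule Cauchy_has_contour_integral_higher_derivative_circlepath)
       (use f r in \<open>auto intro: holomorphic_on_subset holomorphic_on_imp_continuous_on\<close>)
  then have "((\<lambda>t. f (circlepath 0 r t) / (circlepath 0 r t) ^ Suc n *
        (2 * pi * \<i> * r * exp (2 * of_real pi * \<i> * of_real t))) has_integral
      ((2 * pi * \<i>) / fact n * (deriv ^^ n) f 0)) {0..1}"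
    unfolding has_contour_integral
    by (simp add: vector_derivative_circlepath)
  then have "((\<lambda>t. f (circlepath 0 r t) / (circlepath 0 r t) ^ Suc n *
        (2 * pi * \<i> * r * exp (2 * of_real pi * \<i> * of_real t)) / (2 * pi * \<i>)) has_integral
      ((2 * pi * \<i>) / fact n * (deriv ^^ n) f 0) / (2 * pi * \<i>)) {0..1}"
    by (rule has_integral_divide)
  then show ?thesis
    using r by (simp add: circlepath field_simps)
qed

section \<open>Gaussian weight, Weyl translations and membership in the Fock space\<close>

text \<open>The weight is free of \<open>p\<close>: the Fock integrand is the \<open>p\<close>-th
  power of \<open>cmod (f z) * fock_weight z\<close>.\<close>

definition fock_weight :: "complex \<Rightarrow> real" where
  "fock_weight z = exp (- ((cmod z)\<^sup>2 / 2))"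

text \<open>Translation by \<open>m\<close>, corrected by a factor that offsets the change of the
  Gaussian weight. Applied to the constant 1, \<open>weyl (- w)\<close> gives the normalized
  reproducing kernel at \<open>w\<close>.\<close>

definition weyl :: "complex \<Rightarrow> (complex \<Rightarrow> complex) \<Rightarrow> complex \<Rightarrow> complex" where
  "weyl m f = (\<lambda>z. exp (- cnj m * z - of_real ((cmod m)\<^sup>2 / 2)) * f (z + m))"

lemma fock_weight_pos: "0 < fock_weight z"
  by (simp add: fock_weight_def)

text \<open>The exponential factor completes the square in the exponent. Hence every norm built from
  the weighted modulus by a translation invariant recipe is preserved.\<close>

lemma cmod_weyl: "cmod (weyl m f z) * fock_weight z = cmod (f (z + m)) * fock_weight (z + m)"
proof -
  have "(cmod (z + m))\<^sup>2 = (cmod z)\<^sup>2 + (cmod m)\<^sup>2 + 2 * Re (cnj m * z)"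
    by (simp only: cmod_power2) (simp add: power2_eq_square algebra_simps)
  then have "- Re (cnj m * z) - (cmod m)\<^sup>2 / 2 - (cmod z)\<^sup>2 / 2 = - ((cmod (z + m))\<^sup>2 / 2)"
    by (simp add: field_simps)
  then show ?thesis
    unfolding weyl_def fock_weight_def norm_mult norm_exp_eq_Re
    by (simp add: exp_add[symmetric] algebra_simps mult_exp_exp)
qed

lemma weyl_holomorphic:
  assumes "f holomorphic_on UNIV"
  shows "weyl m f holomorphic_on UNIV"
proof -
  have "(f \<circ> (\<lambda>z. z + m)) holomorphic_on UNIV"
    by (rule holomorphic_on_compose_gen[OF _ assms]) (auto intro: holomorphic_intros)
  then show ?thesis unfolding weyl_def o_def by (intro holomorphic_intros)
qed

lemma fock_integrand_eq_powr: "fock_integrand p f z = (cmod (f z) * fock_weight z) powr p"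
proof -
  have "fock_weight z powr p = exp (- (p * (cmod z)\<^sup>2 / 2))"
    unfolding fock_weight_def powr_def by (simp add: field_simps)
  then show ?thesis
    unfolding fock_integrand_def by (simp add: powr_mult fock_weight_pos less_imp_le)
qed

lemma fock_integrand_nonneg: "0 \<le> fock_integrand p f z"
  by (simp add: fock_integrand_def)

lemma fock_integrand_scale:
  "fock_integrand p (\<lambda>z. c * f z) z = cmod c powr p * fock_integrand p f z"
  by (simp add: fock_integrand_def norm_mult powr_mult)

lemma fock_integrand_weyl: "fock_integrand p (weyl m f) z = fock_integrand p f (z + m)"
  by (simp add: fock_integrand_eq_powr cmod_weyl)

lemma borel_measurable_entire:
  "f holomorphic_on UNIV \<Longrightarrow> f \<in> borel_measurable borel"
  by (intro borel_measurable_continuous_onI holomorphic_on_imp_continuous_on)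

lemma borel_measurable_fock_integrand:
  assumes "f holomorphic_on UNIV"
  shows "fock_integrand p f \<in> borel_measurable borel"
  using borel_measurable_entire[OF assms] unfolding fock_integrand_def[abs_def] by measurable

lemma
  fixes f :: "'a::euclidean_space \<Rightarrow> real"
  assumes f[measurable]: "f \<in> borel_measurable borel"
  shows integrable_lborel_translate: "integrable lborel (\<lambda>x. f (x + c)) \<longleftrightarrow> integrable lborel f"
    and integral_lborel_translate: "(LINT x|lborel. f (x + c)) = (LINT x|lborel. f x)"
proof -
  have "integrable lborel f \<longleftrightarrow> integrable (distr lborel borel ((+) c)) f"
    by (subst lborel_distr_plus) simp
  also have "\<dots> \<longleftrightarrow> integrable lborel (\<lambda>x. f (x + c))"
    by (subst integrable_distr_eq) (auto simp: add.commute)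
  finally show "integrable lborel (\<lambda>x. f (x + c)) \<longleftrightarrow> integrable lborel f" by simp
  have "(LINT x|lborel. f x) = integral\<^sup>L (distr lborel borel ((+) c)) f"
    by (subst lborel_distr_plus) simp
  also have "\<dots> = (LINT x|lborel. f (x + c))"
    by (subst integral_distr) (auto simp: add.commute)
  finally show "(LINT x|lborel. f (x + c)) = (LINT x|lborel. f x)" by simp
qed

lemma fock_spaceD:
  assumes "f \<in> fock_space p"
  shows "f holomorphic_on UNIV" "integrable lborel (fock_integrand p f)"
  using assms by (auto simp: fock_space_def)

lemma weyl_in_fock_space:
  assumes "f \<in> fock_space p"
  shows "weyl m f \<in> fock_space p"
  using assms weyl_holomorphic
    integrable_lborel_translate[OF borel_measurable_fock_integrand, of f p m]
  by (auto simp: fock_space_def fock_integrand_weyl[abs_def])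

lemma fock_norm_weyl:
  assumes "f \<in> fock_space p"
  shows "fock_norm p (weyl m f) = fock_norm p f"
  using integral_lborel_translate[OF borel_measurable_fock_integrand[OF fock_spaceD(1)[OF assms]], of p m]
  by (simp add: fock_norm_def fock_integrand_weyl[abs_def])

lemma scale_in_fock_space:
  assumes "f \<in> fock_space p"
  shows "(\<lambda>z. c * f z) \<in> fock_space p"
  using assms by (auto simp: fock_space_def fock_integrand_scale[abs_def] intro: holomorphic_intros)

text \<open>The integrand is dominated through \<open>a + b \<le> 2 * max a b\<close>, since the
  \<open>p\<close>-th power of a maximum is at most the sum of the \<open>p\<close>-th
  powers.\<close>

lemma diff_in_fock_space:
  assumes p: "1 \<le> p" and f: "f \<in> fock_space p" and g: "g \<in> fock_space p"
  shows "(\<lambda>z. f z - g z) \<in> fock_space p"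
proof -
  have h: "(\<lambda>z. f z - g z) holomorphic_on UNIV"
    using fock_spaceD(1)[OF f] fock_spaceD(1)[OF g] by (intro holomorphic_intros)
  have "fock_integrand p (\<lambda>z. f z - g z) z
      \<le> 2 powr p * (fock_integrand p f z + fock_integrand p g z)" for z
  proof -
    define a where "a = cmod (f z) * fock_weight z"
    define b where "b = cmod (g z) * fock_weight z"
    have ab: "0 \<le> a" "0 \<le> b" by (auto simp: a_def b_def fock_weight_def)
    have "cmod (f z - g z) * fock_weight z \<le> (cmod (f z) + cmod (g z)) * fock_weight z"
      by (intro mult_right_mono norm_triangle_ineq4 less_imp_le[OF fock_weight_pos])
    also have "\<dots> = a + b" by (simp add: a_def b_def algebra_simps)
    also have "\<dots> \<le> 2 * max a b" by simp
    finally have "(cmod (f z - g z) * fock_weight z) powr p \<le> (2 * max a b) powr p"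
      using p fock_weight_pos[of z] by (intro powr_mono2) auto
    also have "\<dots> = 2 powr p * max a b powr p" using ab by (simp add: powr_mult)
    also have "max a b powr p \<le> a powr p + b powr p" by (auto simp: max_def)
    finally show ?thesis by (simp add: fock_integrand_eq_powr a_def b_def)
  qed
  then have b: "AE z in lborel. norm (fock_integrand p (\<lambda>z. f z - g z) z)
      \<le> norm (2 powr p * (fock_integrand p f z + fock_integrand p g z))"
    by (intro AE_I2) (simp add: fock_integrand_nonneg)
  have "integrable lborel (\<lambda>z. 2 powr p * (fock_integrand p f z + fock_integrand p g z))"
    using fock_spaceD(2)[OF f] fock_spaceD(2)[OF g]
    by (intro integrable_mult_right Bochner_Integration.integrable_add)
  then have "integrable lborel (fock_integrand p (\<lambda>z. f z - g z))"
    by (rule Bochner_Integration.integrable_bound[OF _ _ b])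
       (use borel_measurable_fock_integrand[OF h, of p] in simp)
  then show ?thesis using h by (simp add: fock_space_def)
qed

text \<open>The integrand factors into two one-dimensional Gaussians, each a multiple of a normal
  density of variance \<open>1 / p\<close>.\<close>

lemma one_in_fock_space:
  assumes p: "1 \<le> p"
  shows "(\<lambda>z. 1) \<in> fock_space p"
proof -
  let ?g = "\<lambda>x::real. exp (- (p * x\<^sup>2 / 2))"
  have "?g = (\<lambda>x. sqrt (2 * pi / p) * normal_density 0 (1 / sqrt p) x)"
    using p by (auto simp: normal_density_def real_sqrt_divide real_sqrt_mult power_divide field_simps)
  then have "integrable lborel ?g"
    using integrable_normal_density[of "1 / sqrt p" 0] p by simp
  then have fin: "(\<integral>\<^sup>+x. ?g x \<partial>lborel) < \<infinity>"
    by (simp add: integrable_iff_bounded)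
  have m: "fock_integrand p (\<lambda>z. 1) \<in> borel_measurable borel"
    by (rule borel_measurable_fock_integrand) (rule holomorphic_intros)
  then have m': "(\<lambda>z. ennreal (fock_integrand p (\<lambda>z. 1) z)) \<in> borel_measurable borel"
    by measurable
  have *: "ennreal (fock_integrand p (\<lambda>z. 1) (Complex x y)) = ennreal (?g x) * ennreal (?g y)" for x y
    by (simp add: fock_integrand_def cmod_def ennreal_mult[symmetric] mult_exp_exp algebra_simps
          add_divide_distrib)
  have "(\<integral>\<^sup>+z. fock_integrand p (\<lambda>z. 1) z \<partial>lborel) = (\<integral>\<^sup>+x. ?g x \<partial>lborel) * (\<integral>\<^sup>+x. ?g x \<partial>lborel)"
    unfolding nn_integral_lborel_complex(1)[OF m'] *
    by (simp add: nn_integral_cmult nn_integral_multc)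
  also have "\<dots> < \<infinity>" using fin by (simp add: ennreal_mult_less_top)
  finally have "integrable lborel (fock_integrand p (\<lambda>z. 1))"
    using m by (intro integrableI_nonneg) (auto simp: fock_integrand_nonneg)
  then show ?thesis by (simp add: fock_space_def)
qed

section \<open>Mean value inequalities and bounded point evaluations\<close>

text \<open>Mean value property of the dilated function \<open>f (z * w)\<close> on the unit circle.
  The nonnegative integral over the line prepares the exchange with the integral over
  \<open>w\<close>.\<close>

lemma entire_norm_le_circle_mean:
  assumes f: "f holomorphic_on UNIV"
  shows "ennreal (cmod (f 0)) \<le>
    (\<integral>\<^sup>+t. indicator {0..1::real} t * ennreal (cmod (f (exp (2 * of_real pi * \<i> * of_real t) * w))) \<partial>lborel)"
proof -
  let ?e = "\<lambda>t::real. exp (2 * of_real pi * \<i> * of_real t)"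
  have "(f \<circ> (\<lambda>z. z * w)) holomorphic_on UNIV"
    by (rule holomorphic_on_compose_gen[OF _ f]) (auto intro!: holomorphic_intros)
  then have "(\<lambda>z. f (z * w)) holomorphic_on UNIV" by (simp add: o_def)
  from cauchy_coefficient_circle_mean[OF this, of 1 0]
  have hi: "((\<lambda>t. f (?e t * w)) has_integral f 0) {0..1}" by simp
  have "continuous_on {0..1::real} (\<lambda>t. f (?e t * w))"
    by (rule continuous_on_compose2[OF holomorphic_on_imp_continuous_on[OF f]])
       (auto intro!: continuous_intros)
  then have "continuous_on {0..1::real} (\<lambda>t. cmod (f (?e t * w)))"
    by (rule continuous_on_norm)
  then have io: "(\<lambda>t. cmod (f (?e t * w))) integrable_on {0..1}"
    by (rule integrable_continuous_real)
  have le: "cmod (f 0) \<le> integral {0..1} (\<lambda>t. cmod (f (?e t * w)))"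
    using Henstock_Kurzweil_Integration.integral_norm_bound_integral
      [OF has_integral_integrable[OF hi] io] integral_unique[OF hi] by simp
  have "(\<integral>\<^sup>+t. indicator {0..1::real} t * ennreal (cmod (f (?e t * w))) \<partial>lborel)
      = (\<integral>\<^sup>+t. ennreal (indicator {0..1::real} t * cmod (f (?e t * w))) \<partial>lborel)"
    by (intro nn_integral_cong) (auto split: split_indicator)
  also have "\<dots> = ennreal (integral {0..1} (\<lambda>t. cmod (f (?e t * w))))"
    by (rule nn_integral_has_integral_lebesgue) (use io in auto)
  finally show ?thesis using le by (simp add: ennreal_leI)
qed

text \<open>Averaging over rotations takes the place of polar coordinates: integrate the circle mean
  over \<open>w\<close> in the disc, swap the integrals, and let rotation invariance remove
  \<open>t\<close>.\<close>

lemma entire_norm_le_disc_mean: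
  assumes f: "f holomorphic_on UNIV"
  shows "ennreal (cmod (f 0)) * emeasure lborel (cball (0::complex) 1)
    \<le> (\<integral>\<^sup>+w. indicator (cball 0 1) w * ennreal (cmod (f w)) \<partial>lborel)"
proof -
  define e where "e = (\<lambda>t::real. exp (2 * of_real pi * \<i> * of_real t))"
  let ?D = "cball (0::complex) 1"
  let ?I = "indicator {0..1::real} :: real \<Rightarrow> ennreal"
  note [measurable] = borel_measurable_entire[OF f]
  have ne: "cmod (e t) = 1" for t by (simp add: e_def norm_exp_eq_Re)
  have [measurable]: "e \<in> borel_measurable borel"
    unfolding e_def by (intro borel_measurable_continuous_onI continuous_intros)
  have [measurable]: "?D \<in> sets borel" by simp
  have "ennreal (cmod (f 0)) * emeasure lborel ?D = (\<integral>\<^sup>+w. indicator ?D w * ennreal (cmod (f 0)) \<partial>lborel)"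
    by (subst nn_integral_cmult_indicator[symmetric]) (auto simp: mult.commute)
  also have "\<dots> \<le> (\<integral>\<^sup>+w. indicator ?D w * (\<integral>\<^sup>+t. ?I t * ennreal (cmod (f (e t * w))) \<partial>lborel) \<partial>lborel)"
    unfolding e_def by (intro nn_integral_mono mult_left_mono entire_norm_le_circle_mean[OF f]) auto
  also have "\<dots> = (\<integral>\<^sup>+w. \<integral>\<^sup>+t. ?I t * (indicator ?D w * ennreal (cmod (f (e t * w)))) \<partial>lborel \<partial>lborel)"
    by (intro nn_integral_cong, subst nn_integral_cmult[symmetric]) (auto simp: mult_ac)
  also have "\<dots> = (\<integral>\<^sup>+t. \<integral>\<^sup>+w. ?I t * (indicator ?D w * ennreal (cmod (f (e t * w)))) \<partial>lborel \<partial>lborel)"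
    by (rule lborel_pair.Fubini') measurable
  also have "\<dots> = (\<integral>\<^sup>+t. ?I t * (\<integral>\<^sup>+w. indicator ?D w * ennreal (cmod (f w)) \<partial>lborel) \<partial>lborel)"
  proof (rule nn_integral_cong)
    fix t :: real
    have i: "indicator ?D w = (indicator ?D (e t * w) :: ennreal)" for w
      by (simp add: indicator_def norm_mult ne)
    have "(\<integral>\<^sup>+w. indicator ?D w * ennreal (cmod (f (e t * w))) \<partial>lborel)
       = (\<integral>\<^sup>+w. indicator ?D (e t * w) * ennreal (cmod (f (e t * w))) \<partial>lborel)"
      by (simp only: i[symmetric])
    also have "\<dots> = (\<integral>\<^sup>+w. indicator ?D w * ennreal (cmod (f w)) \<partial>lborel)"
      by (rule nn_integral_lborel_rotate[OF _ ne]) measurable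
    finally show "(\<integral>\<^sup>+w. ?I t * (indicator ?D w * ennreal (cmod (f (e t * w)))) \<partial>lborel)
       = ?I t * (\<integral>\<^sup>+w. indicator ?D w * ennreal (cmod (f w)) \<partial>lborel)"
      by (subst nn_integral_cmult) auto
  qed
  also have "\<dots> = (\<integral>\<^sup>+w. indicator ?D w * ennreal (cmod (f w)) \<partial>lborel)"
    by (subst nn_integral_multc) auto
  finally show ?thesis .
qed

lemma entire_at_0_le_fock_integral:
  assumes p: "1 \<le> p"
  obtains K where "0 \<le> K"
    "\<And>f. f \<in> fock_space p \<Longrightarrow> cmod (f 0) \<le> 1 + K * (LINT z|lborel. fock_integrand p f z)"
proof
  let ?D = "cball (0::complex) 1"
  define \<mu> where "\<mu> = measure lborel ?D"
  have \<mu>: "emeasure lborel ?D = ennreal \<mu>"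
    unfolding \<mu>_def using emeasure_lborel_cball_finite[of "0::complex" 1]
    by (intro emeasure_eq_ennreal_measure) auto
  have \<mu>0: "0 < \<mu>"
    unfolding \<mu>_def by (simp add: content_cball_pos)
  \<comment> \<open>The numerator is the largest value of the reciprocal Gaussian weight on the unit
    disc; the denominator is the area of the disc.\<close>
  define K where "K = exp (p / 2) / \<mu>"
  show "0 \<le> K" using \<mu>0 by (simp add: K_def)
  fix f assume f: "f \<in> fock_space p"
  note hol = fock_spaceD(1)[OF f] and int = fock_spaceD(2)[OF f]
  let ?I = "LINT z|lborel. fock_integrand p f z"
  have le: "indicator ?D w * ennreal (cmod (f w)) \<le>
      indicator ?D w + ennreal (exp (p / 2) * fock_integrand p f w)" for w
  proof (cases "w \<in> ?D")
    case True
    \<comment> \<open>This crude inequality replaces Jensen; the inhomogeneous bound it gives is made linear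
      in the norm afterwards by rescaling.\<close>
    have "cmod (f w) \<le> 1 + cmod (f w) powr p"
    proof (cases "1 \<le> cmod (f w)")
      case True
      have "cmod (f w) powr 1 \<le> cmod (f w) powr p" using True p by (intro powr_mono) auto
      then show ?thesis using True by simp
    qed (simp add: add_increasing2)
    also have "cmod (f w) powr p = exp (p * (cmod w)\<^sup>2 / 2) * fock_integrand p f w"
      by (simp add: fock_integrand_def mult_exp_exp algebra_simps)
    also have "\<dots> \<le> exp (p / 2) * fock_integrand p f w"
    proof (intro mult_right_mono fock_integrand_nonneg)
      have "(cmod w)\<^sup>2 \<le> 1" using True by (simp add: power_le_one)
      then have "p * (cmod w)\<^sup>2 \<le> p * 1" using p by (intro mult_left_mono) auto
      then show "exp (p * (cmod w)\<^sup>2 / 2) \<le> exp (p / 2)" by simp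
    qed
    finally have "cmod (f w) \<le> 1 + exp (p / 2) * fock_integrand p f w" by simp
    then have "ennreal (cmod (f w)) \<le> ennreal (1 + exp (p / 2) * fock_integrand p f w)"
      by (rule ennreal_leI)
    then show ?thesis using True by (simp add: ennreal_plus fock_integrand_nonneg)
  qed simp
  have meas: "fock_integrand p f \<in> borel_measurable lborel"
    using borel_measurable_fock_integrand[OF hol] by simp
  have "ennreal (cmod (f 0)) * emeasure lborel ?D
      \<le> (\<integral>\<^sup>+w. indicator ?D w * ennreal (cmod (f w)) \<partial>lborel)"
    by (rule entire_norm_le_disc_mean[OF hol])
  also have "\<dots> \<le> (\<integral>\<^sup>+w. indicator ?D w + ennreal (exp (p / 2) * fock_integrand p f w) \<partial>lborel)"
    by (intro nn_integral_mono le)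
  also have "\<dots> = emeasure lborel ?D + (\<integral>\<^sup>+w. ennreal (exp (p / 2) * fock_integrand p f w) \<partial>lborel)"
    by (subst nn_integral_add) (use meas in \<open>auto intro!: borel_measurable_indicator\<close>)
  also have "(\<integral>\<^sup>+w. ennreal (exp (p / 2) * fock_integrand p f w) \<partial>lborel)
      = ennreal (exp (p / 2) * ?I)"
    by (subst nn_integral_eq_integral) (use int in \<open>auto simp: fock_integrand_nonneg\<close>)
  also have "emeasure lborel ?D + ennreal (exp (p / 2) * ?I) = ennreal (\<mu> + exp (p / 2) * ?I)"
    using \<mu>0 by (simp add: \<mu> ennreal_plus integral_nonneg_AE fock_integrand_nonneg)
  finally have "ennreal (cmod (f 0) * \<mu>) \<le> ennreal (\<mu> + exp (p / 2) * ?I)"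
    using \<mu>0 by (simp add: \<mu> ennreal_mult)
  then have "cmod (f 0) * \<mu> \<le> \<mu> + exp (p / 2) * ?I"
    using \<mu>0 by (subst (asm) ennreal_le_iff) (auto simp: fock_integrand_nonneg)
  then show "cmod (f 0) \<le> 1 + K * ?I"
    using \<mu>0 by (simp add: K_def field_simps)
qed

lemma fock_norm_nonneg: "0 \<le> fock_norm p f"
  by (simp add: fock_norm_def)

text \<open>Rescaling \<open>f\<close> to norm 1 makes the bound at 0 homogeneous; a Weyl
  translation, which keeps the norm, carries it to every other point.\<close>

lemma fock_pointwise_bound:
  assumes p: "1 \<le> p"
  obtains C where "0 < C"
    "\<And>f w. f \<in> fock_space p \<Longrightarrow> cmod (f w) * fock_weight w \<le> C * fock_norm p f"
proof -
  obtain K where K: "0 \<le> K"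
    "\<And>f. f \<in> fock_space p \<Longrightarrow> cmod (f 0) \<le> 1 + K * (LINT z|lborel. fock_integrand p f z)"
    using entire_at_0_le_fock_integral[OF p] by blast
  define C where "C = 1 + K * (2 * pi / p)"
  have C: "0 < C" using K p by (simp add: C_def add_pos_nonneg)
  have zero: "cmod (f 0) \<le> C * fock_norm p f" if f: "f \<in> fock_space p" for f
  proof -
    define \<nu> where "\<nu> = fock_norm p f"
    define I where "I = (LINT z|lborel. fock_integrand p f z)"
    have I0: "0 \<le> I" by (simp add: I_def fock_integrand_nonneg)
    have sc: "cmod c * cmod (f 0) \<le> 1 + K * (cmod c powr p * I)" for c
      using K(2)[OF scale_in_fock_space[OF f, of c]]
      by (simp add: fock_integrand_scale norm_mult I_def)
    have \<nu>p: "\<nu> powr p = p / (2 * pi) * I"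
      using p I0 by (simp add: \<nu>_def fock_norm_def I_def[symmetric] powr_powr)
    show ?thesis
    proof (cases "\<nu> = 0")
      case True
      then have "I = 0" using \<nu>p p by simp
      \<comment> \<open>The integral of every multiple of \<open>f\<close> vanishes as well, so
        arbitrarily large multiples of \<open>f 0\<close> stay in the unit disc.\<close>
      then have "real n * cmod (f 0) \<le> 1" for n
        using sc[of "of_nat n"] by simp
      then have "\<not> 0 < cmod (f 0)"
        using reals_Archimedean3[of "cmod (f 0)"] by (metis not_less)
      then show ?thesis using True by (simp add: \<nu>_def)
    next
      case False
      then have \<nu>: "0 < \<nu>" using fock_norm_nonneg[of p f] by (simp add: \<nu>_def)
      have "inverse \<nu> powr p * I = inverse (\<nu> powr p) * I"
        using \<nu> by (simp add: inverse_powr)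
      also have "\<dots> = 2 * pi / p"
        using \<nu>p \<nu> p by (simp add: field_simps split: if_splits)
      finally have "inverse \<nu> * cmod (f 0) \<le> C"
        using sc[of "of_real (inverse \<nu>)"] \<nu> by (simp add: C_def norm_inverse)
      then show ?thesis using \<nu> by (simp add: \<nu>_def[symmetric] field_simps)
    qed
  qed
  show ?thesis
  proof
    show "0 < C" by fact
    fix f w assume f: "f \<in> fock_space p"
    have "cmod (f w) * fock_weight w = cmod (weyl w f 0)"
      using cmod_weyl[of w f 0] by (simp add: fock_weight_def)
    also have "\<dots> \<le> C * fock_norm p f"
      using zero[OF weyl_in_fock_space[OF f, of w]] by (simp add: fock_norm_weyl[OF f])
    finally show "cmod (f w) * fock_weight w \<le> C * fock_norm p f" .
  qed
qed

section \<open>The symbols of a bounded operator\<close>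

lemma weighted_comp_weight_bound:
  assumes p: "1 \<le> p"
    and T: "bounded_linear_operator_on (fock_space p) (fock_norm p) (weighted_comp u \<psi>)"
  obtains C where "0 < C" "\<And>z. cmod (u z) * fock_weight z \<le> C * fock_weight (\<psi> z)"
proof -
  obtain C1 where C1: "0 < C1"
    "\<And>f w. f \<in> fock_space p \<Longrightarrow> cmod (f w) * fock_weight w \<le> C1 * fock_norm p f"
    using fock_pointwise_bound[OF p] by blast
  obtain C2 where TC: "\<And>f. f \<in> fock_space p \<Longrightarrow> weighted_comp u \<psi> f \<in> fock_space p"
      "\<And>f. f \<in> fock_space p \<Longrightarrow> fock_norm p (weighted_comp u \<psi> f) \<le> C2 * fock_norm p f"
    using T unfolding bounded_linear_operator_on_def by blast
  define D where "D = C1 * (C2 * fock_norm p (\<lambda>z. 1))"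
  \<comment> \<open>The maximum with 1 secures a positive constant, as the sign of \<open>C2\<close>
    is not known.\<close>
  have "cmod (u z) * fock_weight z \<le> max 1 D * fock_weight (\<psi> z)" for z
  proof -
    \<comment> \<open>The normalized reproducing kernel at \<open>\<psi> z\<close>.\<close>
    define k where "k = weyl (- \<psi> z) (\<lambda>z. 1)"
    have k: "k \<in> fock_space p" "fock_norm p k = fock_norm p (\<lambda>z. 1)"
      unfolding k_def using one_in_fock_space[OF p] by (auto intro: weyl_in_fock_space fock_norm_weyl)
    have k1: "cmod (k (\<psi> z)) * fock_weight (\<psi> z) = 1"
      unfolding k_def cmod_weyl by (simp add: fock_weight_def)
    have "cmod (weighted_comp u \<psi> k z) * fock_weight z \<le> C1 * fock_norm p (weighted_comp u \<psi> k)"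
      by (intro C1 TC k)
    also have "\<dots> \<le> D"
      unfolding D_def using C1(1) TC(2)[OF k(1)] by (simp add: k(2))
    also have "\<dots> \<le> max 1 D" by simp
    finally have "cmod (u z) * fock_weight z * cmod (k (\<psi> z)) \<le> max 1 D"
      by (simp add: weighted_comp_def norm_mult mult_ac)
    then have "cmod (u z) * fock_weight z * cmod (k (\<psi> z)) * fock_weight (\<psi> z)
        \<le> max 1 D * fock_weight (\<psi> z)"
      by (intro mult_right_mono less_imp_le[OF fock_weight_pos])
    then show ?thesis using k1 by (simp add: mult.assoc)
  qed
  then show ?thesis by (intro that[of "max 1 D"]) auto
qed

section \<open>Affine form of the composition symbol\<close>

lemma two_Re_le_cmod_sq: "2 * Re (cnj c * x) \<le> (cmod x)\<^sup>2 + (cmod c)\<^sup>2"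
proof -
  have "0 \<le> (cmod (x - c))\<^sup>2" by simp
  then show ?thesis
    unfolding cmod_power2 by (simp add: power2_eq_square algebra_simps)
qed

text \<open>Average the hypothesis over the circle of radius \<open>r\<close>:
  \<open>Re (h z)\<close> has mean \<open>Re (h 0)\<close>, and
  \<open>(cmod (\<psi> z))\<^sup>2\<close> has mean at least the square of any single Taylor
  term.\<close>

lemma taylor_coefficient_bound:
  assumes h: "h holomorphic_on UNIV" and \<psi>: "\<psi> holomorphic_on UNIV"
    and le: "\<And>z. 2 * Re (h z) + (cmod (\<psi> z))\<^sup>2 \<le> (cmod z)\<^sup>2 + K" and r: "0 < r"
  shows "(cmod ((deriv ^^ n) \<psi> 0 / fact n) * r ^ n)\<^sup>2 \<le> r\<^sup>2 + (K - 2 * Re (h 0))"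
proof -
  define a where "a = (deriv ^^ n) \<psi> 0 / fact n"
  define c where "c = a * of_real r ^ n"
  define e where "e = (\<lambda>t::real. exp (2 * of_real pi * \<i> * of_real t))"
  have e: "cmod (e t) = 1" for t by (simp add: e_def norm_exp_eq_Re)
  \<comment> \<open>Linearizing \<open>\<bar>\<psi>\<bar>\<^sup>2\<close> around the Taylor term yields the Parseval lower bound for one coefficient
    from a mean of a holomorphic function.\<close>
  define G where "G = (\<lambda>t. 2 * h (of_real r * e t)
      + 2 * cnj c * of_real r ^ n * (\<psi> (of_real r * e t) / (of_real r * e t) ^ n))"
  have 1: "((\<lambda>t. h (of_real r * e t)) has_integral h 0) {0..1}"
    using cauchy_coefficient_circle_mean[OF h r, of 0] by (simp add: e_def)
  have 2: "((\<lambda>t. \<psi> (of_real r * e t) / (of_real r * e t) ^ n) has_integral a) {0..1}"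
    using cauchy_coefficient_circle_mean[OF \<psi> r, of n] by (simp add: e_def a_def)
  have G: "(G has_integral 2 * h 0 + 2 * cnj c * of_real r ^ n * a) {0..1}"
    unfolding G_def by (intro has_integral_add has_integral_mult_right 1 2)
  have "2 * cnj c * of_real r ^ n * a = 2 * (cnj c * c)" by (simp add: c_def)
  also have "cnj c * c = of_real ((cmod c)\<^sup>2)" by (metis complex_norm_square mult.commute)
  finally have eq: "2 * cnj c * of_real r ^ n * a = of_real (2 * (cmod c)\<^sup>2)" by simp
  have Gc: "Re (2 * h 0 + 2 * cnj c * of_real r ^ n * a) = 2 * Re (h 0) + 2 * (cmod c)\<^sup>2"
    unfolding eq plus_complex.sel Re_complex_of_real by simp
  have "((\<lambda>t. Re (G t)) has_integral 2 * Re (h 0) + 2 * (cmod c)\<^sup>2) {0..1}"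
    using has_integral_Re[OF G] unfolding Gc .
  moreover have "((\<lambda>t. r\<^sup>2 + K + (cmod c)\<^sup>2) has_integral r\<^sup>2 + K + (cmod c)\<^sup>2) {0..1::real}"
    using has_integral_const_real[of "r\<^sup>2 + K + (cmod c)\<^sup>2" 0 1] by simp
  ultimately have "2 * Re (h 0) + 2 * (cmod c)\<^sup>2 \<le> r\<^sup>2 + K + (cmod c)\<^sup>2"
  proof (rule has_integral_le)
    fix t :: real
    let ?z = "of_real r * e t"
    have "2 * Re (cnj c * (\<psi> ?z / e t ^ n)) \<le> (cmod (\<psi> ?z / e t ^ n))\<^sup>2 + (cmod c)\<^sup>2"
      by (rule two_Re_le_cmod_sq)
    also have "cmod (\<psi> ?z / e t ^ n) = cmod (\<psi> ?z)"
      by (simp add: norm_divide norm_power e)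
    finally have A: "2 * Re (cnj c * (\<psi> ?z / e t ^ n)) \<le> (cmod (\<psi> ?z))\<^sup>2 + (cmod c)\<^sup>2" .
    have B: "2 * Re (h ?z) + (cmod (\<psi> ?z))\<^sup>2 \<le> r\<^sup>2 + K"
      using le[of ?z] r by (simp add: norm_mult e)
    have "e t \<noteq> 0" using e[of t] by auto
    then have "G t = 2 * h ?z + 2 * (cnj c * (\<psi> ?z / e t ^ n))"
      using r by (simp add: G_def power_mult_distrib)
    moreover have "Re (2 * w) = 2 * Re w" for w by simp
    ultimately have "Re (G t) = 2 * Re (h ?z) + 2 * Re (cnj c * (\<psi> ?z / e t ^ n))"
      by (simp only: plus_complex.sel)
    then show "Re (G t) \<le> r\<^sup>2 + K + (cmod c)\<^sup>2" using A B by linarith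
  qed
  moreover have "cmod c = cmod a * r ^ n" using r by (simp add: c_def norm_mult norm_power)
  ultimately show ?thesis by (simp add: a_def)
qed

lemma nonpos_if_quadratic_bounded:
  fixes x K :: real
  assumes "\<And>r. 1 \<le> r \<Longrightarrow> x * r\<^sup>2 \<le> K"
  shows "x \<le> 0"
proof (rule ccontr)
  assume "\<not> x \<le> 0"
  then have x: "0 < x" by simp
  define r where "r = max 1 ((\<bar>K\<bar> + 1) / x)"
  have r: "1 \<le> r" "(\<bar>K\<bar> + 1) / x \<le> r" by (auto simp: r_def)
  have "\<bar>K\<bar> + 1 \<le> x * r" using r(2) x by (simp add: field_simps)
  also have "\<dots> \<le> x * r\<^sup>2" using r(1) x by (simp add: power2_eq_square)
  also have "\<dots> \<le> K" by (rule assms[OF r(1)])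
  finally show False by simp
qed

text \<open>Taking logarithms of the weight bound gives the growth inequality behind
  \<open>taylor_coefficient_bound\<close>. Letting \<open>r\<close> grow then restricts the Taylor
  coefficients of \<psi>.\<close>

lemma weighted_comp_symbol_form:
  assumes u: "u holomorphic_on UNIV" and \<psi>: "\<psi> holomorphic_on UNIV" and nz: "\<And>z. u z \<noteq> 0"
    and C: "0 < C" "\<And>z. cmod (u z) * fock_weight z \<le> C * fock_weight (\<psi> z)"
  obtains a b where "\<And>z. \<psi> z = a * z + b" "cmod a \<le> 1"
    "cmod a = 1 \<Longrightarrow> \<forall>z. u z = u 0 * exp (- a * cnj b * z)"
proof -
  obtain h where h: "h holomorphic_on UNIV" "\<And>z. u z = exp (h z)"
    using holomorphic_logarithm_exists[OF _ open_UNIV u] nz by (metis UNIV_I convex_UNIV)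
  have le: "2 * Re (h z) + (cmod (\<psi> z))\<^sup>2 \<le> (cmod z)\<^sup>2 + 2 * ln C" for z
  proof -
    have "exp (Re (h z)) * fock_weight z \<le> exp (ln C) * fock_weight (\<psi> z)"
      using C(2)[of z] C(1) by (simp add: h(2) norm_exp_eq_Re)
    then show ?thesis
      unfolding fock_weight_def mult_exp_exp exp_le_cancel_iff by (simp add: field_simps)
  qed
  define K where "K = 2 * ln C - 2 * Re (h 0)"
  define a where "a n = (deriv ^^ n) \<psi> 0 / fact n" for n
  have bound: "(cmod (a n) * r ^ n)\<^sup>2 \<le> r\<^sup>2 + K" if "0 < r" for n r
    using taylor_coefficient_bound[OF h(1) \<psi> le that, of n] by (simp add: a_def K_def)
  \<comment> \<open>The left side of \<open>bound\<close> grows at least like \<open>r ^ 4\<close>,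
    the right side only like \<open>r ^ 2\<close>.\<close>
  have a0: "a n = 0" if n: "2 \<le> n" for n
  proof -
    have "(cmod (a n))\<^sup>2 * r\<^sup>2 \<le> 1 + \<bar>K\<bar>" if r: "1 \<le> r" for r
    proof -
      have "r ^ 4 \<le> r ^ (2 * n)" using r n by (intro power_increasing) auto
      then have "(cmod (a n))\<^sup>2 * r ^ 4 \<le> (cmod (a n))\<^sup>2 * r ^ (2 * n)" by (intro mult_left_mono) auto
      also have "\<dots> = (cmod (a n) * r ^ n)\<^sup>2"
        by (simp add: power_mult_distrib power_mult mult.commute[of 2 n])
      also have "\<dots> \<le> r\<^sup>2 + K" using bound[of r n] r by simp
      also have "\<dots> \<le> r\<^sup>2 * (1 + \<bar>K\<bar>)"
      proof -
        have "1 \<le> r\<^sup>2" using r by simp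
        then have "1 * \<bar>K\<bar> \<le> r\<^sup>2 * \<bar>K\<bar>" by (intro mult_right_mono) auto
        then show ?thesis by (simp add: algebra_simps)
      qed
      finally have "((cmod (a n))\<^sup>2 * r\<^sup>2) * r\<^sup>2 \<le> (1 + \<bar>K\<bar>) * r\<^sup>2"
        by (simp add: algebra_simps power2_eq_square power4_eq_xxxx)
      then show ?thesis using r by (subst (asm) mult_le_cancel_right) auto
    qed
    from nonpos_if_quadratic_bounded[OF this] show ?thesis by simp
  qed
  have a1: "cmod (a 1) \<le> 1"
  proof -
    have "((cmod (a 1))\<^sup>2 - 1) * r\<^sup>2 \<le> K" if "1 \<le> r" for r
      using bound[of r 1] that by (simp add: power_mult_distrib algebra_simps)
    from nonpos_if_quadratic_bounded[OF this] show ?thesis using abs_square_le_1[of "cmod (a 1)"] by simp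
  qed
  have \<psi>_eq: "\<psi> z = a 1 * z + a 0" for z
  proof -
    have "(\<lambda>n. (deriv ^^ n) \<psi> 0 / fact n * (z - 0) ^ n) sums \<psi> z"
      by (rule holomorphic_power_series[of _ _ "cmod z + 1"])
         (use holomorphic_on_subset[OF \<psi>] in auto)
    then have "(\<lambda>n. a n * z ^ n) sums \<psi> z" by (simp add: a_def)
    moreover have "(\<lambda>n. a n * z ^ n) sums (\<Sum>n\<in>{0,1}. a n * z ^ n)"
    proof (rule sums_finite)
      fix n :: nat assume "n \<notin> {0, 1}"
      then have "2 \<le> n" by auto
      then show "a n * z ^ n = 0" by (simp add: a0)
    qed simp
    ultimately have "\<psi> z = (\<Sum>n\<in>{0,1}. a n * z ^ n)" by (rule sums_unique2)
    then show ?thesis by simp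
  qed
  show ?thesis
  proof
    show "\<psi> z = a 1 * z + a 0" for z by (rule \<psi>_eq)
    show "cmod (a 1) \<le> 1" by (rule a1)
    assume one: "cmod (a 1) = 1"
    \<comment> \<open>For \<open>cmod (a 1) = 1\<close> the quadratic parts of both weights cancel.
      The factor beside \<open>u\<close> cancels the remaining cross term of
      \<open>(cmod (\<psi> z))\<^sup>2\<close>, so \<open>F\<close> is bounded.\<close>
    define F where "F = (\<lambda>z. u z * exp (a 1 * cnj (a 0) * z))"
    have "F holomorphic_on UNIV" unfolding F_def by (intro holomorphic_intros u)
    moreover have "bounded (range F)"
    proof (rule boundedI)
      fix x assume "x \<in> range F"
      then obtain z where x: "x = F z" by auto
      have "(cmod (\<psi> z))\<^sup>2 = (cmod (a 1 * z))\<^sup>2 + 2 * Re (a 1 * cnj (a 0) * z) + (cmod (a 0))\<^sup>2"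
        unfolding \<psi>_eq cmod_power2 by (simp add: power2_eq_square algebra_simps)
      moreover define s where "s = Re (a 1 * cnj (a 0) * z)"
      ultimately have q: "(cmod (\<psi> z))\<^sup>2 / 2 = (cmod z)\<^sup>2 / 2 + s + (cmod (a 0))\<^sup>2 / 2"
        using one by (simp add: norm_mult)
      have "cmod (u z) * exp s = (cmod (u z) * fock_weight z) * exp ((cmod z)\<^sup>2 / 2 + s)"
        by (simp add: fock_weight_def mult_exp_exp mult.assoc)
      also have "\<dots> \<le> (C * fock_weight (\<psi> z)) * exp ((cmod z)\<^sup>2 / 2 + s)"
        by (intro mult_right_mono C(2)) simp
      also have "\<dots> = C * exp (- ((cmod (a 0))\<^sup>2 / 2))"
        unfolding fock_weight_def q by (simp add: mult.assoc mult_exp_exp)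
      also have "\<dots> \<le> C * 1" using C(1) by (intro mult_left_mono) auto
      finally show "cmod x \<le> C"
        by (simp add: x F_def s_def norm_mult norm_exp_eq_Re)
    qed
    ultimately have "F constant_on UNIV" by (rule Liouville_theorem)
    then have "F z = F 0" for z by (auto simp: constant_on_def)
    then show "\<forall>z. u z = u 0 * exp (- a 1 * cnj (a 0) * z)"
      unfolding F_def by (auto simp: exp_minus field_simps)
  qed
qed

section \<open>Orbits when the symbol has a fixed point\<close>

text \<open>The pointwise bound turns norm approximation into uniform weighted approximation, the
  form in which density is exploited below.\<close>

lemma fock_dense_approx:
  assumes p: "1 \<le> p" and dense: "norm_dense_in (fock_space p) (fock_norm p) S"
    and g: "g \<in> fock_space p" and \<delta>: "0 < \<delta>"
  obtains h where "h \<in> S" "h \<in> fock_space p" "\<And>w. cmod (g w - h w) * fock_weight w < \<delta>"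
proof -
  obtain C where C: "0 < C"
    "\<And>f w. f \<in> fock_space p \<Longrightarrow> cmod (f w) * fock_weight w \<le> C * fock_norm p f"
    using fock_pointwise_bound[OF p] by blast
  have sub: "S \<subseteq> fock_space p"
    and ex: "\<exists>h\<in>S. fock_norm p (\<lambda>z. g z - h z) < \<delta> / C"
    using dense g \<delta> C(1) unfolding norm_dense_in_def by auto
  obtain h where h: "h \<in> S" "fock_norm p (\<lambda>z. g z - h z) < \<delta> / C" using ex by blast
  have hF: "h \<in> fock_space p" using h sub by blast
  show ?thesis
  proof (rule that[OF h(1) hF])
    fix w
    have "cmod (g w - h w) * fock_weight w \<le> C * fock_norm p (\<lambda>z. g z - h z)"
      by (rule C(2)[OF diff_in_fock_space[OF p g hF]])
    also have "\<dots> < \<delta>" using h(2) C(1) by (simp add: field_simps)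
    finally show "cmod (g w - h w) * fock_weight w < \<delta>" .
  qed
qed

text \<open>Up to a constant factor this is the normalized reproducing kernel at
  \<open>t\<close>.\<close>

lemma exp_in_fock_space:
  assumes p: "1 \<le> p"
  shows "(\<lambda>z. exp (of_real t * (z - z0))) \<in> fock_space p"
proof -
  have "(\<lambda>z. exp (of_real t * (z - z0)))
      = (\<lambda>z. exp (of_real (t\<^sup>2 / 2) - of_real t * z0) * weyl (- of_real t) (\<lambda>z. 1) z)"
    by (simp add: weyl_def mult_exp_exp algebra_simps)
  then show ?thesis
    using scale_in_fock_space[OF weyl_in_fock_space[OF one_in_fock_space[OF p]]] by metis
qed

text \<open>An orbit element near an exponential that is 1 at \<open>z0\<close> and huge at
  \<open>z0 + 1\<close> would violate the ratio bound. Being near 1 at \<open>z0\<close>, it cannot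
  fall under the vanishing alternative.\<close>

lemma not_dense_orbit_if_ratio_bounded:
  assumes p: "1 \<le> p"
    and ratio: "\<And>n. (T ^^ n) f z0 = 0 \<or> cmod ((T ^^ n) f (z0 + 1)) \<le> M * cmod ((T ^^ n) f z0)"
  shows "\<not> norm_dense_in (fock_space p) (fock_norm p) (projective_orbit T f)"
proof
  assume dense: "norm_dense_in (fock_space p) (fock_norm p) (projective_orbit T f)"
  \<comment> \<open>Orbit elements with modulus at most 2 at \<open>z0\<close> have modulus at most
    \<open>t - 1\<close> at \<open>z0 + 1\<close>, while \<open>exp t\<close> is at least
    \<open>t + 1\<close>.\<close>
  define t where "t = \<bar>M\<bar> * 2 + 1"
  define g where "g = (\<lambda>z. exp (of_real t * (z - z0)))"
  have g: "g \<in> fock_space p" unfolding g_def by (rule exp_in_fock_space[OF p])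
  \<comment> \<open>Dividing by the weight leaves an error below 1/2 at both points.\<close>
  define \<delta> where "\<delta> = min (fock_weight z0) (fock_weight (z0 + 1)) / 2"
  have \<delta>: "0 < \<delta>" by (simp add: \<delta>_def fock_weight_pos)
  obtain h where h: "h \<in> projective_orbit T f"
    and close: "\<And>w. cmod (g w - h w) * fock_weight w < \<delta>"
    using fock_dense_approx[OF p dense g \<delta>] by blast
  have near: "cmod (g w - h w) < 1 / 2" if "w \<in> {z0, z0 + 1}" for w
  proof -
    have "cmod (g w - h w) * fock_weight w < 1 / 2 * fock_weight w"
      using close[of w] that by (auto simp: \<delta>_def)
    then show ?thesis using fock_weight_pos[of w] by (subst (asm) mult_less_cancel_right) auto
  qed
  have n0: "cmod (1 - h z0) < 1 / 2" using near[of z0] by (simp add: g_def)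
  have n1: "cmod (exp (of_real t) - h (z0 + 1)) < 1 / 2" using near[of "z0 + 1"] by (simp add: g_def)
  obtain c n where hc: "h = (\<lambda>z. c * (T ^^ n) f z)" using h unfolding projective_orbit_def by blast
  have hz0: "h z0 \<noteq> 0" using n0 by auto
  then have "cmod ((T ^^ n) f (z0 + 1)) \<le> M * cmod ((T ^^ n) f z0)"
    using ratio[of n] by (auto simp: hc)
  then have "cmod c * cmod ((T ^^ n) f (z0 + 1)) \<le> cmod c * (M * cmod ((T ^^ n) f z0))"
    by (intro mult_left_mono) auto
  then have "cmod (h (z0 + 1)) \<le> M * cmod (h z0)" by (simp add: hc norm_mult mult_ac)
  also have "\<dots> \<le> \<bar>M\<bar> * 2"
  proof -
    have "cmod (h z0) \<le> 2" using n0 norm_triangle_ineq2[of "h z0" 1] by (simp add: norm_minus_commute)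
    then have "\<bar>M\<bar> * cmod (h z0) \<le> \<bar>M\<bar> * 2" by (intro mult_left_mono) auto
    moreover have "M * cmod (h z0) \<le> \<bar>M\<bar> * cmod (h z0)" by (intro mult_right_mono) auto
    ultimately show ?thesis by linarith
  qed
  also have "\<dots> = t - 1" by (simp add: t_def)
  finally have "cmod (h (z0 + 1)) \<le> t - 1" .
  moreover have "cmod (exp (of_real t :: complex)) = exp t" by (simp add: norm_exp_eq_Re)
  moreover have "1 + t \<le> exp t" by (rule exp_ge_add_one_self)
  moreover have "cmod (exp (of_real t)) - cmod (h (z0 + 1)) \<le> cmod (exp (of_real t) - h (z0 + 1))"
    by (rule norm_triangle_ineq2)
  ultimately show False using n1 by linarith
qed

lemma weighted_comp_funpow_Suc:
  "(weighted_comp u \<psi> ^^ Suc n) f z = u z * (weighted_comp u \<psi> ^^ n) f (\<psi> z)"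
  by (simp add: weighted_comp_def)

lemma weighted_comp_funpow_fixed:
  "\<psi> z0 = z0 \<Longrightarrow> (weighted_comp u \<psi> ^^ n) f z0 = u z0 ^ n * f z0"
  by (induction n) (simp_all add: weighted_comp_funpow_Suc del: funpow.simps(2))

text \<open>The weight \<open>\<Gamma>\<close> absorbs the product of the values of \<open>u\<close> along an orbit of \<open>\<psi>\<close>.\<close>

lemma weighted_comp_funpow_bound:
  assumes S: "\<psi> ` S \<subseteq> S" and B: "0 \<le> B" and q: "0 \<le> q"
    and u: "\<And>w. w \<in> S \<Longrightarrow> cmod (u w) * \<Gamma> (\<psi> w) \<le> q * \<Gamma> w"
    and f: "\<And>w. w \<in> S \<Longrightarrow> cmod (f w) \<le> B * \<Gamma> w" and w: "w \<in> S"
  shows "cmod ((weighted_comp u \<psi> ^^ n) f w) \<le> q ^ n * B * \<Gamma> w"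
  using w
proof (induction n arbitrary: w)
  case 0
  then show ?case using f by simp
next
  case (Suc n)
  have "cmod ((weighted_comp u \<psi> ^^ Suc n) f w) = cmod (u w) * cmod ((weighted_comp u \<psi> ^^ n) f (\<psi> w))"
    by (simp add: weighted_comp_funpow_Suc norm_mult del: funpow.simps(2))
  also have "\<dots> \<le> cmod (u w) * (q ^ n * B * \<Gamma> (\<psi> w))"
    using Suc S by (intro mult_left_mono) auto
  also have "\<dots> = q ^ n * B * (cmod (u w) * \<Gamma> (\<psi> w))" by simp
  also have "\<dots> \<le> q ^ n * B * (q * \<Gamma> w)" using u[OF Suc.prems] B q by (intro mult_left_mono) auto
  finally show ?case by (simp add: mult_ac)
qed

text \<open>At \<open>z0\<close> the iterates have modulus exactly
  \<open>cmod (u z0) ^ n * cmod (f z0)\<close>. The weight \<Gamma> gives an upper bound with the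
  same growth rate on the invariant disc, so the quotients stay bounded.\<close>

lemma not_dense_orbit_if_fixed_point:
  assumes p: "1 \<le> p" and f: "f \<in> fock_space p" and fp: "\<psi> z0 = z0"
    and S: "\<psi> ` cball z0 1 \<subseteq> cball z0 1" and \<Gamma>: "continuous_on (cball z0 1) \<Gamma>" "\<And>w. 0 < \<Gamma> w"
    and u: "\<And>w. w \<in> cball z0 1 \<Longrightarrow> cmod (u w) * \<Gamma> (\<psi> w) \<le> cmod (u z0) * \<Gamma> w"
  shows "\<not> norm_dense_in (fock_space p) (fock_norm p) (projective_orbit (weighted_comp u \<psi>) f)"
proof -
  let ?T = "weighted_comp u \<psi>"
  have "continuous_on (cball z0 1) (\<lambda>w. cmod (f w) / \<Gamma> w)"
    using \<Gamma>(2) holomorphic_on_imp_continuous_on[OF holomorphic_on_subset[OF fock_spaceD(1)[OF f]]]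
    by (intro continuous_intros \<Gamma>(1)) (auto simp: less_imp_neq[symmetric])
  then have "bounded ((\<lambda>w. cmod (f w) / \<Gamma> w) ` cball z0 1)"
    by (intro compact_imp_bounded compact_continuous_image) auto
  then obtain B where B: "0 < B" "\<And>w. w \<in> cball z0 1 \<Longrightarrow> \<bar>cmod (f w) / \<Gamma> w\<bar> \<le> B"
    unfolding bounded_pos by auto
  have fB: "cmod (f w) \<le> B * \<Gamma> w" if "w \<in> cball z0 1" for w
    using B(2)[OF that] \<Gamma>(2)[of w] by (simp add: field_simps)
  show ?thesis
  proof (rule not_dense_orbit_if_ratio_bounded[OF p])
    fix n
    show "(?T ^^ n) f z0 = 0 \<or>
      cmod ((?T ^^ n) f (z0 + 1)) \<le> (B * \<Gamma> (z0 + 1) / cmod (f z0)) * cmod ((?T ^^ n) f z0)"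
    proof (cases "f z0 = 0")
      case False
      have "cmod ((?T ^^ n) f (z0 + 1)) \<le> cmod (u z0) ^ n * B * \<Gamma> (z0 + 1)"
        by (rule weighted_comp_funpow_bound[where \<Gamma> = \<Gamma>, OF S _ _ u fB]) (use B(1) in \<open>auto simp: dist_norm\<close>)
      then show ?thesis
        using False by (simp add: weighted_comp_funpow_fixed[where \<psi> = \<psi>, OF fp] norm_mult norm_power mult_ac)
    qed (simp add: weighted_comp_funpow_fixed[where \<psi> = \<psi>, OF fp])
  qed
qed

text \<open>All iterates from the first on vanish at \<open>z0\<close>; the ratio constant only has
  to serve \<open>n = 0\<close>.\<close>

lemma not_dense_orbit_if_weight_zero:
  assumes p: "1 \<le> p" and z0: "u z0 = 0"
  shows "\<not> norm_dense_in (fock_space p) (fock_norm p) (projective_orbit (weighted_comp u \<psi>) f)"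
proof (rule not_dense_orbit_if_ratio_bounded[OF p])
  fix n
  show "(weighted_comp u \<psi> ^^ n) f z0 = 0 \<or> cmod ((weighted_comp u \<psi> ^^ n) f (z0 + 1))
      \<le> (cmod (f (z0 + 1)) / cmod (f z0)) * cmod ((weighted_comp u \<psi> ^^ n) f z0)"
    using z0 by (cases n) (auto simp: weighted_comp_funpow_Suc simp del: funpow.simps(2))
qed

text \<open>Mean value inequality on a disc. An error linear in the distance becomes summable along
  a contracting orbit.\<close>

lemma entire_norm_lipschitz_at:
  assumes u: "u holomorphic_on UNIV"
  obtains L where "0 \<le> L" "\<And>w. w \<in> cball z0 1 \<Longrightarrow> cmod (u w) \<le> cmod (u z0) + L * cmod (w - z0)"
proof -
  have "continuous_on (cball z0 1) (deriv u)"
    by (intro holomorphic_on_imp_continuous_on holomorphic_on_subset[OF holomorphic_deriv[OF u]]) auto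
  then have "bounded (deriv u ` cball z0 1)"
    by (intro compact_imp_bounded compact_continuous_image) auto
  then obtain L where L: "0 < L" "\<And>w. w \<in> cball z0 1 \<Longrightarrow> cmod (deriv u w) \<le> L"
    unfolding bounded_pos by auto
  show ?thesis
  proof
    show "0 \<le> L" using L by simp
    fix w assume w: "w \<in> cball z0 1"
    have "cmod (u w - u z0) \<le> L * cmod (w - z0)"
    proof (rule field_differentiable_bound[of "cball z0 1" u "deriv u"])
      fix z assume "z \<in> cball z0 1"
      show "(u has_field_derivative deriv u z) (at z within cball z0 1)"
        using holomorphic_derivI[OF u open_UNIV UNIV_I] by (rule has_field_derivative_at_within)
      show "cmod (deriv u z) \<le> L" by (rule L(2)) fact
    qed (use w in auto)
    then show "cmod (u w) \<le> cmod (u z0) + L * cmod (w - z0)"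
      using norm_triangle_ineq2[of "u w" "u z0"] by linarith
  qed
qed

lemma not_dense_orbit_if_contraction:
  assumes p: "1 \<le> p" and f: "f \<in> fock_space p" and u: "u holomorphic_on UNIV"
    and u0: "u z0 \<noteq> 0" and \<psi>: "\<And>z. \<psi> z = z0 + a * (z - z0)" and a: "cmod a < 1"
  shows "\<not> norm_dense_in (fock_space p) (fock_norm p) (projective_orbit (weighted_comp u \<psi>) f)"
proof -
  obtain L' where L': "0 \<le> L'"
    "\<And>w. w \<in> cball z0 1 \<Longrightarrow> cmod (u w) \<le> cmod (u z0) + L' * cmod (w - z0)"
    using entire_norm_lipschitz_at[OF u] by blast
  define L where "L = L' / cmod (u z0)"
  \<comment> \<open>Each factor \<open>cmod (u w) / cmod (u z0)\<close> is at most
    \<open>exp (L * cmod (w - z0))\<close>. Along the orbit these exponents form a geometric series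
    of ratio \<open>cmod a\<close>, summed here.\<close>
  define \<Gamma> where "\<Gamma> = (\<lambda>w. exp (L * cmod (w - z0) / (1 - cmod a)))"
  show ?thesis
  proof (rule not_dense_orbit_if_fixed_point[OF p f, of \<psi> z0 \<Gamma>])
    show "\<psi> ` cball z0 1 \<subseteq> cball z0 1"
    proof
      fix y assume "y \<in> \<psi> ` cball z0 1"
      then obtain w where "w \<in> cball z0 1" and y: "y = \<psi> w" by blast
      then have w: "cmod (w - z0) \<le> 1" by (simp add: dist_norm norm_minus_commute)
      have "cmod a * cmod (w - z0) \<le> 1 * 1" using a w by (intro mult_mono) auto
      then show "y \<in> cball z0 1" by (simp add: y \<psi> dist_norm norm_mult)
    qed
    show "continuous_on (cball z0 1) \<Gamma>"
      unfolding \<Gamma>_def using a by (intro continuous_intros) auto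
    fix w assume w: "w \<in> cball z0 1"
    let ?r = "cmod (w - z0)"
    have "cmod (u w) \<le> cmod (u z0) * (1 + L * ?r)"
      using L'(2)[OF w] u0 by (simp add: L_def distrib_left)
    also have "\<dots> \<le> cmod (u z0) * exp (L * ?r)"
      by (intro mult_left_mono exp_ge_add_one_self) auto
    finally have "cmod (u w) * \<Gamma> (\<psi> w) \<le> cmod (u z0) * exp (L * ?r) * \<Gamma> (\<psi> w)"
      by (intro mult_right_mono) (auto simp: \<Gamma>_def)
    also have "\<dots> = cmod (u z0) * exp (L * ?r + L * (cmod a * ?r) / (1 - cmod a))"
      by (simp add: \<Gamma>_def \<psi> norm_mult exp_add)
    also have "L * ?r + L * (cmod a * ?r) / (1 - cmod a) = L * ?r / (1 - cmod a)"
      using a by (simp add: field_simps)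
    finally show "cmod (u w) * \<Gamma> (\<psi> w) \<le> cmod (u z0) * \<Gamma> w" by (simp add: \<Gamma>_def)
  qed (auto simp: \<psi> \<Gamma>_def)
qed

lemma not_dense_orbit_if_rotation:
  assumes p: "1 \<le> p" and f: "f \<in> fock_space p" and z0: "a * z0 + b = z0" and a: "cmod a = 1"
    and ab: "a \<noteq> 1 \<or> b = 0" and u: "\<And>z. u z = u 0 * exp (- a * cnj b * z)"
    and \<psi>: "\<And>z. \<psi> z = a * z + b"
  shows "\<not> norm_dense_in (fock_space p) (fock_norm p) (projective_orbit (weighted_comp u \<psi>) f)"
proof -
  define c where "c = - a * cnj b"
  \<comment> \<open>The formal sum of the geometric series of ratio \<open>a\<close>: it diverges in
    general on the unit circle, but its closed form still solves the required identity. For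
    \<open>a = 1\<close> the assumption \<open>ab\<close> gives \<open>c = 0\<close>, and \<Gamma>
    is constantly 1.\<close>
  define \<Gamma> where "\<Gamma> = (\<lambda>w. exp (Re (c * (w - z0) / (1 - a))))"
  have norm_u: "cmod (u z) = cmod (u 0) * exp (Re (c * z))" for z
    using arg_cong[OF u[of z], of cmod] unfolding c_def norm_mult norm_exp_eq_Re .
  have \<psi>': "\<psi> w - z0 = a * (w - z0)" for w using z0 by (simp add: \<psi> algebra_simps)
  show ?thesis
  proof (rule not_dense_orbit_if_fixed_point[OF p f, of \<psi> z0 \<Gamma>])
    show "\<psi> z0 = z0" using z0 by (simp add: \<psi>)
    show "\<psi> ` cball z0 1 \<subseteq> cball z0 1"
      using \<psi>' a by (auto simp: dist_norm norm_mult norm_minus_commute[of z0])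
    show "continuous_on (cball z0 1) \<Gamma>"
    proof (cases "a = 1")
      case False
      then show ?thesis unfolding \<Gamma>_def by (intro continuous_intros) auto
    qed (simp add: \<Gamma>_def)
    fix w assume w: "w \<in> cball z0 1"
    have e: "c * w + c * (\<psi> w - z0) / (1 - a) = c * z0 + c * (w - z0) / (1 - a)"
      unfolding \<psi>' using ab by (auto simp: c_def field_simps)
    have "cmod (u w) * \<Gamma> (\<psi> w) = cmod (u 0) * exp (Re (c * w + c * (\<psi> w - z0) / (1 - a)))"
      by (simp only: \<Gamma>_def norm_u[of w] plus_complex.sel exp_add mult.assoc)
    also have "\<dots> = cmod (u z0) * \<Gamma> w"
      by (simp only: e \<Gamma>_def norm_u[of z0] plus_complex.sel exp_add mult.assoc)
    finally show "cmod (u w) * \<Gamma> (\<psi> w) \<le> cmod (u z0) * \<Gamma> w" by simp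
  qed (auto simp: \<Gamma>_def)
qed

section \<open>Orbits of translations\<close>

text \<open>The Fock norm for \<open>p = \<infinity>\<close>. Weyl translations preserve it, and on
  combinations of distant Gaussian bumps it can be estimated point by point.\<close>

definition fock_sup :: "(complex \<Rightarrow> complex) \<Rightarrow> real" where
  "fock_sup f = (SUP z. cmod (f z) * fock_weight z)"

lemma fock_sup_le: "(\<And>z. cmod (f z) * fock_weight z \<le> x) \<Longrightarrow> fock_sup f \<le> x"
  unfolding fock_sup_def by (rule cSUP_least) auto

text \<open>Point evaluation bounds keep the supremum finite on the Fock space.\<close>

lemma le_fock_sup:
  assumes p: "1 \<le> p" and f: "f \<in> fock_space p"
  shows "cmod (f z) * fock_weight z \<le> fock_sup f"
proof -
  obtain C where "\<And>w. cmod (f w) * fock_weight w \<le> C * fock_norm p f"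
    using fock_pointwise_bound[OF p] f by metis
  then have "bdd_above (range (\<lambda>z. cmod (f z) * fock_weight z))" by (intro bdd_aboveI) auto
  then show ?thesis unfolding fock_sup_def by (rule cSUP_upper[OF UNIV_I])
qed

lemma fock_sup_nonneg:
  assumes p: "1 \<le> p" and f: "f \<in> fock_space p"
  shows "0 \<le> fock_sup f"
  using le_fock_sup[OF assms, of 0] by (rule order_trans[rotated]) (simp add: fock_weight_def)

lemma fock_sup_weyl: "fock_sup (weyl m f) = fock_sup f"
proof -
  have "range (\<lambda>z. cmod (f (z + m)) * fock_weight (z + m)) = range (\<lambda>z. cmod (f z) * fock_weight z)"
    by (auto simp: image_iff) (metis diff_add_cancel)
  then show ?thesis by (simp add: fock_sup_def cmod_weyl)
qed

lemma fock_sup_scale: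
  assumes p: "1 \<le> p" and f: "f \<in> fock_space p"
  shows "fock_sup (\<lambda>z. c * f z) = cmod c * fock_sup f"
proof (rule antisym)
  have le: "fock_sup (\<lambda>z. c * f z) \<le> cmod c * fock_sup f" if "f \<in> fock_space p" for c f
    using le_fock_sup[OF p that] by (intro fock_sup_le) (simp add: norm_mult mult.assoc mult_left_mono)
  show "fock_sup (\<lambda>z. c * f z) \<le> cmod c * fock_sup f" by (rule le[OF f])
  show "cmod c * fock_sup f \<le> fock_sup (\<lambda>z. c * f z)"
  proof (cases "c = 0")
    case True
    then show ?thesis by (simp add: fock_sup_def)
  next
    case False
    have "fock_sup f = fock_sup (\<lambda>z. inverse c * (c * f z))" using False by (simp add: mult.assoc[symmetric])
    also have "\<dots> \<le> cmod (inverse c) * fock_sup (\<lambda>z. c * f z)"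
      by (rule le[OF scale_in_fock_space[OF f]])
    finally show ?thesis using False by (simp add: norm_divide field_simps)
  qed
qed

lemma fock_sup_diff_le:
  assumes p: "1 \<le> p" and f: "f \<in> fock_space p" and g: "g \<in> fock_space p"
    and le: "\<And>w. cmod (f w - g w) * fock_weight w \<le> \<delta>"
  shows "\<bar>fock_sup f - fock_sup g\<bar> \<le> \<delta>"
proof -
  have *: "fock_sup f \<le> fock_sup g + \<delta>"
    if g: "g \<in> fock_space p" and le: "\<And>w. cmod (f w - g w) * fock_weight w \<le> \<delta>" for f g
  proof (rule fock_sup_le)
    fix z
    have "cmod (f z) * fock_weight z \<le> (cmod (g z) + cmod (f z - g z)) * fock_weight z"
      using norm_triangle_ineq[of "g z" "f z - g z"]
      by (intro mult_right_mono less_imp_le[OF fock_weight_pos]) simp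
    also have "\<dots> \<le> fock_sup g + \<delta>"
      using le_fock_sup[OF p g, of z] le[of z] by (simp add: algebra_simps)
    finally show "cmod (f z) * fock_weight z \<le> fock_sup g + \<delta>" .
  qed
  show ?thesis
    using *[OF g le] *[OF f, of g] le by (simp add: norm_minus_commute abs_le_iff)
qed

section \<open>Powers of a Weyl translation and their orbits\<close>

lemma weyl_linear:
  "weyl m (\<lambda>z. f z - g z) z = weyl m f z - weyl m g z"
  "weyl m (\<lambda>z. c * f z) z = c * weyl m f z"
  by (simp_all add: weyl_def algebra_simps)

text \<open>Weyl translations compose up to a unimodular phase given by the imaginary part of a
  product; for real multiples of one \<open>b\<close> that product is real and the phase
  disappears.\<close>

lemma weyl_weyl_multiple:
  "weyl (of_real s * b) (weyl (of_real t * b) f) = weyl (of_real (s + t) * b) f"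
proof
  fix z
  have sq: "(cmod (of_real x * b))\<^sup>2 = x\<^sup>2 * (cmod b)\<^sup>2" for x
    by (simp add: norm_mult power_mult_distrib)
  have "(cmod (of_real (s + t) * b))\<^sup>2 / 2 = (cmod (of_real s * b))\<^sup>2 / 2 + (cmod (of_real t * b))\<^sup>2 / 2
      + s * t * (cmod b)\<^sup>2" (is "?l = ?r")
    unfolding sq by (simp add: power2_eq_square[of "s + t"] power2_eq_square[of s] power2_eq_square[of t]
        algebra_simps add_divide_distrib)
  then have "complex_of_real ?l = complex_of_real ?r" by (rule arg_cong)
  moreover have "cnj b * b = of_real ((cmod b)\<^sup>2)"
    by (metis complex_norm_square mult.commute)
  ultimately have r: "complex_of_real ((cmod (of_real (s + t) * b))\<^sup>2 / 2) = of_real ((cmod (of_real s * b))\<^sup>2 / 2)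
      + of_real ((cmod (of_real t * b))\<^sup>2 / 2) + of_real (s * t) * (cnj b * b)"
    by (simp only: of_real_add of_real_mult)
  have z: "z + of_real s * b + of_real t * b = z + of_real (s + t) * b"
    by (simp add: algebra_simps)
  have "exp (- cnj (of_real s * b) * z - of_real ((cmod (of_real s * b))\<^sup>2 / 2)) *
      exp (- cnj (of_real t * b) * (z + of_real s * b) - of_real ((cmod (of_real t * b))\<^sup>2 / 2))
    = exp (- cnj (of_real (s + t) * b) * z - of_real ((cmod (of_real (s + t) * b))\<^sup>2 / 2))"
    unfolding r mult_exp_exp by (rule arg_cong[where f = exp]) (simp add: algebra_simps)
  then show "weyl (of_real s * b) (weyl (of_real t * b) f) z = weyl (of_real (s + t) * b) f z"
    unfolding weyl_def z[symmetric] by (simp add: mult.assoc[symmetric])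
qed

lemma not_dense_orbit_if_translation:
  assumes p: "1 \<le> p" and f: "f \<in> fock_space p" and b: "b \<noteq> 0"
    and T: "\<And>g. T g = (\<lambda>z. \<kappa> * weyl b g z)"
  shows "\<not> norm_dense_in (fock_space p) (fock_norm p) (projective_orbit T f)"
proof
  assume dense: "norm_dense_in (fock_space p) (fock_norm p) (projective_orbit T f)"
  have Tn: "(T ^^ n) f = (\<lambda>z. \<kappa> ^ n * weyl (of_real (real n) * b) f z)" for n
  proof (induction n)
    case 0
    show ?case by (simp add: weyl_def)
  next
    case (Suc n)
    have "(T ^^ Suc n) f = (\<lambda>z. \<kappa> * (\<kappa> ^ n * weyl (of_real 1 * b) (weyl (of_real (real n) * b) f) z))"
      by (simp add: Suc T weyl_linear)
    then show ?case unfolding weyl_weyl_multiple by (simp add: mult.assoc add.commute)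
  qed
  \<comment> \<open>Points at distance at least 9/2 from 0 then have weight at most 1/10, since
    \<open>1 + (9/2)^2 / 2\<close> exceeds 10.\<close>
  obtain n where n: "9 \<le> real n * cmod b"
    using reals_Archimedean3[of "cmod b"] b by (metis less_imp_le zero_less_norm_iff)
  define m where "m = of_real (real n) * b"
  have m: "9 \<le> cmod m" using n by (simp add: m_def norm_mult)
  define \<Delta> where "\<Delta> g = (\<lambda>z. weyl m g z - g z)" for g
  have \<Delta>F: "\<Delta> g \<in> fock_space p" if "g \<in> fock_space p" for g
    unfolding \<Delta>_def by (intro diff_in_fock_space[OF p] weyl_in_fock_space that)
  define s where "s = fock_sup f"
  define d where "d = fock_sup (\<Delta> f)"
  have s0: "0 \<le> s" "0 \<le> d"
    using fock_sup_nonneg[OF p] f \<Delta>F by (auto simp: s_def d_def)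
  \<comment> \<open>\<Delta> commutes with the powers of \<open>weyl b\<close>, which preserve
    \<open>fock_sup\<close>; scalars multiply both norms equally.\<close>
  have orbit: "fock_sup (\<Delta> h) * s = d * fock_sup h" if h: "h \<in> projective_orbit T f" for h
  proof -
    obtain c k where "h = (\<lambda>z. c * (T ^^ k) f z)" using h unfolding projective_orbit_def by blast
    then have h: "h = (\<lambda>z. (c * \<kappa> ^ k) * weyl (of_real (real k) * b) f z)"
      by (simp add: Tn mult.assoc)
    have "weyl m (weyl (of_real (real k) * b) f) = weyl (of_real (real k) * b) (weyl m f)"
      unfolding m_def weyl_weyl_multiple by (simp add: add.commute)
    then have "\<Delta> h = (\<lambda>z. (c * \<kappa> ^ k) * weyl (of_real (real k) * b) (\<Delta> f) z)"
      unfolding \<Delta>_def h weyl_linear by (simp add: algebra_simps)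
    then have "fock_sup (\<Delta> h) = cmod (c * \<kappa> ^ k) * d"
      by (simp only: fock_sup_scale[OF p weyl_in_fock_space[OF \<Delta>F[OF f]]] fock_sup_weyl d_def)
    moreover have "fock_sup h = cmod (c * \<kappa> ^ k) * s"
      unfolding h by (simp only: fock_sup_scale[OF p weyl_in_fock_space[OF f]] fock_sup_weyl s_def)
    ultimately show ?thesis by simp
  qed
  \<comment> \<open>The ratio of the norms of \<open>\<Delta> g\<close> and \<open>g\<close> is constant on the orbit, hence on the whole space; applying
    this to \<open>1\<close> and \<open>\<Delta> 1\<close> makes the norm of \<open>\<Delta> (\<Delta> 1)\<close> the square of that of \<open>\<Delta> 1\<close>. But \<open>1\<close>, \<open>V 1\<close>, \<open>V\<^sup>2 1\<close>
    are far apart Gaussian bumps for \<open>V = weyl m\<close>, which forces norms close to \<open>2\<close> and \<open>1\<close>.\<close>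
  have ratio: "fock_sup (\<Delta> g) * s = d * fock_sup g" if g: "g \<in> fock_space p" for g
  proof -
    define X where "X = fock_sup (\<Delta> g) * s - d * fock_sup g"
    \<comment> \<open>Replacing \<open>g\<close> by a nearby orbit element, where the identity is
      exact, changes its norm by at most \<delta> and that of \<open>\<Delta> g\<close> by at most
      twice as much.\<close>
    have X: "\<bar>X\<bar> \<le> \<delta> * (2 * s + d)" if \<delta>: "0 < \<delta>" for \<delta>
    proof -
      obtain h where h: "h \<in> projective_orbit T f" "h \<in> fock_space p"
        and close: "\<And>w. cmod (g w - h w) * fock_weight w < \<delta>"
        using fock_dense_approx[OF p dense g \<delta>] by blast
      have "\<bar>fock_sup g - fock_sup h\<bar> \<le> \<delta>"
        using close by (intro fock_sup_diff_le[OF p g h(2)] less_imp_le)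
      then have 1: "d * \<bar>fock_sup g - fock_sup h\<bar> \<le> d * \<delta>" using s0 by (intro mult_left_mono)
      have "\<bar>fock_sup (\<Delta> g) - fock_sup (\<Delta> h)\<bar> \<le> 2 * \<delta>"
      proof (rule fock_sup_diff_le[OF p \<Delta>F[OF g] \<Delta>F[OF h(2)]])
        fix w
        have eq: "\<Delta> g w - \<Delta> h w = weyl m (\<lambda>z. g z - h z) w - (g w - h w)"
          by (simp add: \<Delta>_def weyl_linear)
        have "cmod (\<Delta> g w - \<Delta> h w) * fock_weight w
            \<le> (cmod (weyl m (\<lambda>z. g z - h z) w) + cmod (g w - h w)) * fock_weight w"
          unfolding eq by (intro mult_right_mono norm_triangle_ineq4 less_imp_le[OF fock_weight_pos])
        also have "\<dots> = cmod (g (w + m) - h (w + m)) * fock_weight (w + m) + cmod (g w - h w) * fock_weight w"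
          by (simp only: distrib_right cmod_weyl)
        also have "\<dots> \<le> 2 * \<delta>" using close[of w] close[of "w + m"] by linarith
        finally show "cmod (\<Delta> g w - \<Delta> h w) * fock_weight w \<le> 2 * \<delta>" .
      qed
      then have 2: "\<bar>fock_sup (\<Delta> g) - fock_sup (\<Delta> h)\<bar> * s \<le> 2 * \<delta> * s"
        using s0 by (intro mult_right_mono)
      have "X = (fock_sup (\<Delta> g) - fock_sup (\<Delta> h)) * s - d * (fock_sup g - fock_sup h)"
        using orbit[OF h(1)] by (simp add: X_def algebra_simps)
      then have "\<bar>X\<bar> \<le> \<bar>(fock_sup (\<Delta> g) - fock_sup (\<Delta> h)) * s\<bar> + \<bar>d * (fock_sup g - fock_sup h)\<bar>"
        by (simp only: abs_triangle_ineq4)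
      also have "\<dots> = \<bar>fock_sup (\<Delta> g) - fock_sup (\<Delta> h)\<bar> * s + d * \<bar>fock_sup g - fock_sup h\<bar>"
        using s0 by (simp add: abs_mult)
      finally show ?thesis using 1 2 by (simp add: algebra_simps)
    qed
    have "\<bar>X\<bar> \<le> 0"
    proof (rule field_le_epsilon)
      fix e :: real assume "0 < e"
      then have "\<bar>X\<bar> \<le> e / (2 * s + d + 1) * (2 * s + d)"
        using s0 by (intro X divide_pos_pos) auto
      also have "\<dots> \<le> e / (2 * s + d + 1) * (2 * s + d + 1)"
        using s0 \<open>0 < e\<close> by (intro mult_left_mono) auto
      also have "\<dots> = 0 + e" using s0 by simp
      finally show "\<bar>X\<bar> \<le> 0 + e" .
    qed
    then show ?thesis by (simp add: X_def)
  qed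
  define one where "one = (\<lambda>z::complex. 1::complex)"
  have oneF: "one \<in> fock_space p" unfolding one_def by (rule one_in_fock_space[OF p])
  have w1: "fock_weight z \<le> 1" for z by (simp add: fock_weight_def)
  have sup1: "fock_sup one = 1"
  proof (rule antisym)
    show "fock_sup one \<le> 1" by (rule fock_sup_le) (simp add: one_def w1)
    show "1 \<le> fock_sup one" using le_fock_sup[OF p oneF, of 0] by (simp add: one_def fock_weight_def)
  qed
  define A where "A = fock_sup (\<Delta> one)"
  have A0: "0 \<le> A" unfolding A_def by (rule fock_sup_nonneg[OF p \<Delta>F[OF oneF]])
  have As: "A * s = d" using ratio[OF oneF] by (simp add: A_def sup1)
  have Bs: "fock_sup (\<Delta> (\<Delta> one)) * s = d * A"
    using ratio[OF \<Delta>F[OF oneF]] by (simp add: A_def)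
  \<comment> \<open>Otherwise \<open>f\<close>, and with it the whole orbit, vanishes and cannot
    come close to 1. This permits cancelling \<open>s\<close> below.\<close>
  have "s \<noteq> 0"
  proof
    assume "s = 0"
    then have le0: "cmod (f z) * fock_weight z \<le> 0" for z
      using le_fock_sup[OF p f, of z] by (simp add: s_def)
    have f0: "f z = 0" for z
      using le0[of z] fock_weight_pos[of z] by (auto simp: mult_le_0_iff)
    obtain h where h: "h \<in> projective_orbit T f" "cmod (one 0 - h 0) * fock_weight 0 < 1"
      using fock_dense_approx[OF p dense oneF, of 1] by (metis zero_less_one)
    then have "h 0 = 0" unfolding projective_orbit_def by (auto simp: Tn weyl_def f0)
    then show False using h(2) by (simp add: one_def fock_weight_def)
  qed
  then have BA: "fock_sup (\<Delta> (\<Delta> one)) = A * A"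
    using Bs As by (metis mult.assoc mult.commute mult_cancel_right)
  have small: "fock_weight z \<le> 1 / 10" if "cmod m / 2 \<le> cmod z" for z
  proof -
    have "(9 / 2)\<^sup>2 \<le> (cmod z)\<^sup>2" using m that by (intro power_mono) auto
    then have "10 \<le> 1 + (cmod z)\<^sup>2 / 2" by (simp add: power2_eq_square)
    also have "\<dots> \<le> exp ((cmod z)\<^sup>2 / 2)" by (rule exp_ge_add_one_self)
    finally show ?thesis by (simp add: fock_weight_def exp_minus field_simps)
  qed
  \<comment> \<open>The points \<open>z\<close> and \<open>z + m\<close> cannot both lie closer than
    \<open>cmod m / 2\<close> to 0, so at most one of the two bumps exceeds 1/10 at any
    point.\<close>
  have "A \<le> 11 / 10"
    unfolding A_def
  proof (rule fock_sup_le)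
    fix z
    have "cmod (\<Delta> one z) * fock_weight z \<le> (cmod (weyl m one z) + cmod (one z)) * fock_weight z"
      unfolding \<Delta>_def by (intro mult_right_mono norm_triangle_ineq4 less_imp_le[OF fock_weight_pos])
    also have "\<dots> = fock_weight (z + m) + fock_weight z"
      by (simp only: distrib_right cmod_weyl) (simp add: one_def)
    also have "\<dots> \<le> 11 / 10"
    proof -
      have "cmod m \<le> cmod (z + m) + cmod z" using norm_triangle_ineq4[of "z + m" z] by simp
      then consider "cmod m / 2 \<le> cmod z" | "cmod m / 2 \<le> cmod (z + m)" by linarith
      then show ?thesis using small w1[of z] w1[of "z + m"] by cases fastforce+
    qed
    finally show "cmod (\<Delta> one z) * fock_weight z \<le> 11 / 10" .
  qed
  then have "A * A \<le> (11 / 10) * (11 / 10)" using A0 by (intro mult_mono) auto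
  \<comment> \<open>Evaluate at \<open>- m\<close>, the peak of \<open>weyl m one\<close>, which
    enters with coefficient -2; the other two bumps contribute at most 1/10 each. This contradicts
    \<open>A * A \<le> 121 / 100\<close>.\<close>
  moreover have "18 / 10 \<le> fock_sup (\<Delta> (\<Delta> one))"
  proof -
    let ?V = "weyl m one" and ?V2 = "weyl m (weyl m one)" and ?w = "fock_weight (- m)"
    have e: "\<Delta> (\<Delta> one) (- m) = ?V2 (- m) + one (- m) - 2 * ?V (- m)"
      by (simp add: \<Delta>_def weyl_linear)
    have v2: "cmod (?V2 (- m)) * ?w = fock_weight m"
      using cmod_weyl[of m "weyl m one" "- m"] cmod_weyl[of m one 0] by (simp add: one_def)
    have v: "cmod (?V (- m)) * ?w = 1"
      using cmod_weyl[of m one "- m"] by (simp add: one_def fock_weight_def)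
    have "cmod (2 * ?V (- m)) \<le> cmod (\<Delta> (\<Delta> one) (- m)) + cmod (?V2 (- m) + one (- m))"
      unfolding e using norm_triangle_ineq4[of "?V2 (- m) + one (- m)" "?V2 (- m) + one (- m) - 2 * ?V (- m)"]
      by (simp add: add.commute)
    also have "\<dots> \<le> cmod (\<Delta> (\<Delta> one) (- m)) + (cmod (?V2 (- m)) + 1)"
      using norm_triangle_ineq[of "?V2 (- m)" "one (- m)"] by (simp add: one_def)
    finally have "cmod (2 * ?V (- m)) * ?w \<le> (cmod (\<Delta> (\<Delta> one) (- m)) + (cmod (?V2 (- m)) + 1)) * ?w"
      by (intro mult_right_mono less_imp_le[OF fock_weight_pos])
    then have "2 \<le> cmod (\<Delta> (\<Delta> one) (- m)) * ?w + fock_weight m + ?w"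
      using v v2 by (simp add: norm_mult algebra_simps)
    moreover have "cmod (\<Delta> (\<Delta> one) (- m)) * ?w \<le> fock_sup (\<Delta> (\<Delta> one))"
      by (rule le_fock_sup[OF p \<Delta>F[OF \<Delta>F[OF oneF]]])
    moreover have "fock_weight m \<le> 1 / 10" "?w \<le> 1 / 10" using small m by auto
    ultimately show ?thesis by linarith
  qed
  ultimately show False using BA by simp
qed

section \<open>Case distinction on the symbols\<close>

theorem theorem2p1:
  fixes p :: real and u \<psi> :: "complex \<Rightarrow> complex"
  assumes "1 \<le> p"
    and "u holomorphic_on UNIV" and "\<psi> holomorphic_on UNIV"
    and "bounded_linear_operator_on (fock_space p) (fock_norm p) (weighted_comp u \<psi>)"
  shows "\<not> supercyclic_on (fock_space p) (fock_norm p) (weighted_comp u \<psi>)"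
proof -
  let ?T = "weighted_comp u \<psi>"
  have "\<not> norm_dense_in (fock_space p) (fock_norm p) (projective_orbit ?T f)"
    if f: "f \<in> fock_space p" for f
  proof (cases "\<exists>z. u z = 0")
    case True
    then show ?thesis using not_dense_orbit_if_weight_zero[OF assms(1)] by blast
  next
    case False
    then have nz: "u z \<noteq> 0" for z by blast
    obtain C where C: "0 < C" "\<And>z. cmod (u z) * fock_weight z \<le> C * fock_weight (\<psi> z)"
      using weighted_comp_weight_bound[OF assms(1,4)] by blast
    obtain a b where \<psi>: "\<And>z. \<psi> z = a * z + b" and a: "cmod a \<le> 1"
      and u: "cmod a = 1 \<Longrightarrow> \<forall>z. u z = u 0 * exp (- a * cnj b * z)"
      using weighted_comp_symbol_form[OF assms(2,3) nz C] by blast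
    \<comment> \<open>The fixed point of \<psi> for \<open>a \<noteq> 1\<close>. For
      \<open>a = 1\<close> division by zero gives 0, which is fixed when
      \<open>b = 0\<close>.\<close>
    define z0 where "z0 = b / (1 - a)"
    have fp: "a * z0 + b = z0" if "a \<noteq> 1 \<or> b = 0"
      using that by (auto simp: z0_def field_simps)
    consider "cmod a < 1" | "cmod a = 1" "a \<noteq> 1 \<or> b = 0" | "a = 1" "b \<noteq> 0"
      using a by fastforce
    then show ?thesis
    proof cases
      case 1
      then have "a \<noteq> 1" by auto
      then have "\<psi> z = z0 + a * (z - z0)" for z
        using fp by (simp add: \<psi> algebra_simps)
      then show ?thesis
        using not_dense_orbit_if_contraction[OF assms(1) f assms(2) nz] 1 by blast
    next
      case 2
      show ?thesis
        by (rule not_dense_orbit_if_rotation[OF assms(1) f fp[OF 2(2)] 2 _ \<psi>]) (use u 2 in blast)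
    next
      case 3
      \<comment> \<open>With \<open>a = 1\<close> the exponential in \<open>u\<close> is that of
        \<open>weyl b\<close>; only the normalizing constant must be restored.\<close>
      have "?T g = (\<lambda>z. u 0 * exp (of_real ((cmod b)\<^sup>2 / 2)) * weyl b g z)" for g
      proof
        fix z
        have uz: "u z = u 0 * exp (- cnj b * z)"
          using u[THEN spec, of z] 3 by simp
        have W: "weyl b g z = exp (- cnj b * z) / exp (of_real ((cmod b)\<^sup>2 / 2)) * g (z + b)"
          by (simp only: weyl_def exp_diff)
        show "?T g z = u 0 * exp (of_real ((cmod b)\<^sup>2 / 2)) * weyl b g z"
          unfolding weighted_comp_def W uz by (simp add: \<psi> 3)
      qed
      then show ?thesis by (rule not_dense_orbit_if_translation[OF assms(1) f 3(2)])
    qed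
  qed
  then show ?thesis by (auto simp: supercyclic_on_def)
qed

end
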